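(* Let $N\in\mathbb N$, $\alpha\in(0,N)$ and $p\ge1$. Assume that $(u_n)_{n\in\mathbb N}$ is a sequence of measurable functions from $\mathbb R^N$ to $\mathbb R$ that converges to $u:\mathbb R^N\to\mathbb R$ almost everywhere. If the sequence $(I_{\alpha/2}*|u_n|^p)_{n\in\mathbb N}$ is bounded in $L^2(\mathbb R^N)$ and if $u\neq0$ (i.e. $u$ is not almost everywhere zero), then the following conditions are equivalent: (i) $\displaystyle\lim_{n\to\infty}\int_{\mathbb R^N}\Bigl|\,\bigl|I_{\alpha/2}*|u_n|^p\bigr|^2-\bigl|I_{\alpha/2}*|u_n-u|^p\bigr|^2-\bigl|I_{\alpha/2}*|u|^p\bigr|^2\Bigr|=0$; (ii) $\displaystyle\lim_{n\to\infty}\int_{\mathbb R^N}\bigl|I_{\alpha/2}*|u_n|^p\bigr|^2-\bigl|I_{\alpha/2}*|u_n-u|^p\bigr|^2=\int_{\mathbb R^N}\bigl|I_{\alpha/2}*|u|^p\bigr|^2$; (iii) the sequence $(u_n)_{n\in\mathbb N}$ converges to $u$ strongly in $L^p_{\mathrm{loc}}(\mathbb R^N)$; (iv) the sequence $(|u_n|^p)_{n\in\mathbb N}$ converges to $|u|^p$ in the sense of measures; (v) the sequence $(I_{\alpha/2}*|u_n|^p)_{n\in\mathbb N}$ converges to $I_{\alpha/2}*|u|^p$ weakly in $L^2(\mathbb R^N)$.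
   Context: $\mathbb N$ denotes the positive integers. For $\alpha\in(0,N)$ the Riesz potential is $I_\alpha(x)=A_\alpha|x|^{-(N-\alpha)}$ for $x\in\mathbb R^N\setminus\{0\}$, with $A_\alpha=\frac{\Gamma((N-\alpha)/2)}{\Gamma(\alpha/2)\pi^{N/2}2^\alpha}$. Convergence in the sense of measures means $\int_{\mathbb R^N}\varphi|u_n|^p\to\int_{\mathbb R^N}\varphi|u|^p$ for every $\varphi\in C_c(\mathbb R^N)$. *)

theory Defs
  imports "HOL-Analysis.Analysis"
begin

text \<open>
  All integrals over \<open>\<real>\<^sup>N\<close> are taken with respect to the complete measure \<^const>\<open>lebesgue\<close>, so that an
  almost everywhere limit of measurable functions is again measurable.
\<close>

definition riesz_const :: "nat \<Rightarrow> real \<Rightarrow> real" where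
  "riesz_const N \<alpha> =
     Gamma ((real N - \<alpha>) / 2) / (Gamma (\<alpha> / 2) * pi powr (real N / 2) * 2 powr \<alpha>)"

text \<open>At the origin, where the Riesz kernel is undefined, the value below is \<open>0\<close>;
  this affects convolution integrals only on a null set.\<close>

definition riesz_kernel :: "real \<Rightarrow> 'a::euclidean_space \<Rightarrow> real" where
  "riesz_kernel \<alpha> x = riesz_const DIM('a) \<alpha> * norm x powr (- (real DIM('a) - \<alpha>))"

text \<open>
  The convolution \<open>I\<^sub>\<alpha> * f\<close> of a nonnegative function is defined everywhere with values in
  \<open>[0, \<infinity>]\<close>. The extended value matters when \<open>L\<^sup>2\<close>-boundedness is a hypothesis: the Bochner
  integral would turn a divergent convolution into \<open>0\<close>.
\<close>

definition riesz_conv :: "real \<Rightarrow> ('a::euclidean_space \<Rightarrow> real) \<Rightarrow> 'a \<Rightarrow> ennreal" where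
  "riesz_conv \<alpha> f x = (\<integral>\<^sup>+y. ennreal (riesz_kernel \<alpha> (x - y) * f y) \<partial>lebesgue)"

text \<open>The real-valued version, to be used for convolutions that are finite almost everywhere.\<close>

definition riesz_potential :: "real \<Rightarrow> ('a::euclidean_space \<Rightarrow> real) \<Rightarrow> 'a \<Rightarrow> real" where
  "riesz_potential \<alpha> f x = enn2real (riesz_conv \<alpha> f x)"

definition bounded_in_L2 :: "(nat \<Rightarrow> 'a::euclidean_space \<Rightarrow> ennreal) \<Rightarrow> bool" where
  "bounded_in_L2 F \<longleftrightarrow> (\<exists>C::real. \<forall>n. (\<integral>\<^sup>+x. (F n x)\<^sup>2 \<partial>lebesgue) \<le> ennreal C)"

definition in_Lp_loc :: "real \<Rightarrow> ('a::euclidean_space \<Rightarrow> real) \<Rightarrow> bool" where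
  "in_Lp_loc p f \<longleftrightarrow>
     f \<in> borel_measurable lebesgue \<and>
     (\<forall>K. compact K \<longrightarrow> (\<integral>\<^sup>+x\<in>K. ennreal (\<bar>f x\<bar> powr p) \<partial>lebesgue) < \<infinity>)"

definition converges_in_Lp_loc ::
  "real \<Rightarrow> (nat \<Rightarrow> 'a::euclidean_space \<Rightarrow> real) \<Rightarrow> ('a \<Rightarrow> real) \<Rightarrow> bool" where
  "converges_in_Lp_loc p F f \<longleftrightarrow>
     (\<forall>n. in_Lp_loc p (F n)) \<and> in_Lp_loc p f \<and>
     (\<forall>K. compact K \<longrightarrow>
       (\<lambda>n. \<integral>\<^sup>+x\<in>K. ennreal (\<bar>F n x - f x\<bar> powr p) \<partial>lebesgue) \<longlonglongrightarrow> 0)"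

definition Cc :: "('a::euclidean_space \<Rightarrow> real) set" where
  "Cc = {\<phi>. continuous_on UNIV \<phi> \<and> compact (closure (support_on UNIV \<phi>))}"

text \<open>Integrability is required explicitly because the Bochner integral of a non-integrable
  function is \<open>0\<close> by convention.\<close>

definition converges_in_measures ::
  "(nat \<Rightarrow> 'a::euclidean_space \<Rightarrow> real) \<Rightarrow> ('a \<Rightarrow> real) \<Rightarrow> bool" where
  "converges_in_measures F f \<longleftrightarrow>
     (\<forall>\<phi>\<in>Cc.
        (\<forall>n. integrable lebesgue (\<lambda>x. \<phi> x * F n x)) \<and>
        integrable lebesgue (\<lambda>x. \<phi> x * f x) \<and>
        (\<lambda>n. \<integral>x. \<phi> x * F n x \<partial>lebesgue) \<longlonglongrightarrow> (\<integral>x. \<phi> x * f x \<partial>lebesgue))"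

definition L2 :: "('a::euclidean_space \<Rightarrow> real) set" where
  "L2 = {f. f \<in> borel_measurable lebesgue \<and> integrable lebesgue (\<lambda>x. (f x)\<^sup>2)}"

definition converges_weakly_L2 ::
  "(nat \<Rightarrow> 'a::euclidean_space \<Rightarrow> real) \<Rightarrow> ('a \<Rightarrow> real) \<Rightarrow> bool" where
  "converges_weakly_L2 F f \<longleftrightarrow>
     (\<forall>n. F n \<in> L2) \<and> f \<in> L2 \<and>
     (\<forall>g\<in>L2. (\<lambda>n. \<integral>x. F n x * g x \<partial>lebesgue) \<longlonglongrightarrow> (\<integral>x. f x * g x \<partial>lebesgue))"

definition all_equivalent :: "bool list \<Rightarrow> bool" where
  "all_equivalent Ps \<longleftrightarrow> (\<forall>P\<in>set Ps. \<forall>Q\<in>set Ps. P \<longleftrightarrow> Q)"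

end

theory Submission
  imports Defs
begin

text \<open>
  Write \<open>T = I\<^bsub>\<alpha>/2\<^esub> * _\<close>, \<open>f\<^sub>n = |u\<^sub>n|\<^sup>p\<close>, \<open>f = |u|\<^sup>p\<close> and \<open>g\<^sub>n = |u\<^sub>n - u|\<^sup>p\<close>. Everything rests on the positivity of
  the Riesz kernel, which is bounded below by a positive constant on every
  ball about the origin with its centre removed: for \<open>|x| \<le> r\<close>,
  \<open>T h (x) \<ge> \<kappa>\<^sub>r \<integral>\<^bsub>B\<^sub>r\<^esub> h\<close> with \<open>\<kappa>\<^sub>r > 0\<close> (lemma \<open>riesz_op_lower\<close>). In particular an \<open>L\<^sup>2\<close> bound on
  \<open>T h\<close> controls \<open>h\<close> in \<open>L\<^sup>1\<close> on balls, and a nonnegative sequence whose potentials tend to zero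
  against one nontrivial nonnegative test function tends to zero in \<open>L\<^sup>1\<close> on balls
  (\<open>riesz_op_locally_null_of_test\<close>). The converse also holds: if \<open>T h\<^sub>n\<close> is bounded in \<open>L\<^sup>2\<close> and
  \<open>h\<^sub>n \<rightarrow> 0\<close> in \<open>L\<^sup>1\<close> on balls, then \<open>T h\<^sub>n\<close> tends weakly to zero (\<open>riesz_op_weakly_null\<close>). Near the
  singularity this uses that the kernel is locally integrable. Far away it uses that the contribution of the
  complement of a large ball \<open>B\<^sub>R\<close> is, up to a constant, below every value of \<open>T h\<^sub>n\<close> on \<open>B\<^sub>R\<close>, hence
  small because \<open>T h\<^sub>n\<close> has bounded \<open>L\<^sup>2\<close> norm while \<open>B\<^sub>R\<close> has large volume.

  All five conditions are reduced to \<open>g\<^sub>n \<rightarrow> 0\<close> in \<open>L\<^sup>1\<close> on balls, which is (iii). By dominated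
  convergence with convergent dominating functions this is the same as \<open>|f\<^sub>n - f| \<rightarrow> 0\<close> in \<open>L\<^sup>1\<close> on balls,
  and the same argument identifies that with (iv).

  For (v), one direction is the weak convergence \<open>T |f\<^sub>n - f| \<rightharpoonup> 0\<close>. For the other, split
  \<open>f\<^sub>n + (f - f\<^sub>n)\<^sup>+ = f + (f\<^sub>n - f)\<^sup>+\<close>. The function \<open>(f - f\<^sub>n)\<^sup>+\<close> is dominated by \<open>f\<close> and tends to zero, so its
  potential tends to zero strongly in \<open>L\<^sup>2\<close>; hence \<open>T (f\<^sub>n - f)\<^sup>+\<close> tends to zero weakly, and positivity of
  the kernel gives local convergence.

  For (i) and (ii), the inequality of Brezis and Lieb, \<open>|f\<^sub>n - g\<^sub>n - f| \<le> \<epsilon> g\<^sub>n + C\<^sub>\<epsilon> f\<close>, shows that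
  \<open>T |f\<^sub>n - g\<^sub>n - f| \<rightarrow> 0\<close> in \<open>L\<^sup>2\<close>. Therefore \<open>(T f\<^sub>n)\<^sup>2 - (T g\<^sub>n)\<^sup>2 - (T f)\<^sup>2\<close> equals \<open>2 (T g\<^sub>n) (T f)\<close> up to an
  error that tends to zero in \<open>L\<^sup>1\<close>. As the cross term is nonnegative, (i) and (ii) both say that
  \<open>\<integral> (T g\<^sub>n) (T f) \<rightarrow> 0\<close>. Since \<open>u \<noteq> 0\<close>, the function \<open>T f\<close> is positive everywhere, and the two lemmas on
  potentials turn this into \<open>g\<^sub>n \<rightarrow> 0\<close> in \<open>L\<^sup>1\<close> on balls.
\<close>

section \<open>The Riesz kernel\<close>

lemma riesz_const_pos:
  assumes "0 < \<beta>" "\<beta> < real N"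
  shows "0 < riesz_const N \<beta>"
  using assms unfolding riesz_const_def by (intro divide_pos_pos mult_pos_pos Gamma_real_pos) auto

lemma riesz_kernel_nonneg:
  fixes x :: "'a::euclidean_space"
  assumes "0 < \<beta>" "\<beta> < real DIM('a)"
  shows "0 \<le> riesz_kernel \<beta> x"
  using riesz_const_pos[OF assms] unfolding riesz_kernel_def by simp

lemma borel_measurable_riesz_kernel [measurable]:
  "riesz_kernel \<beta> \<in> borel_measurable borel"
  unfolding riesz_kernel_def[abs_def] by measurable

text \<open>
  The kernel decreases like a negative power of the distance, so enlarging the distance by a factor
  of at most \<open>t\<close> costs a constant. The value \<open>0\<close> of the kernel at the origin is why \<open>z \<noteq> 0\<close> is needed.
\<close>

lemma riesz_kernel_compare:
  fixes z w :: "'a::euclidean_space"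
  assumes \<beta>: "0 < \<beta>" "\<beta> < real DIM('a)" and z: "z \<noteq> 0" and t: "0 < t" "norm z \<le> t * norm w"
  shows "riesz_kernel \<beta> w \<le> t powr (real DIM('a) - \<beta>) * riesz_kernel \<beta> z"
proof -
  define s where "s = real DIM('a) - \<beta>"
  have "norm w powr (- s) \<le> (norm z / t) powr (- s)"
    using t z \<beta> by (intro powr_mono2') (auto simp: s_def divide_simps mult.commute)
  also have "\<dots> = t powr s * norm z powr (- s)"
    using t z by (simp add: powr_divide powr_minus field_simps)
  finally show ?thesis
    using riesz_const_pos[OF \<beta>] by (simp add: riesz_kernel_def flip: s_def)
qed

lemma riesz_kernel_lower:
  fixes z :: "'a::euclidean_space"
  assumes \<beta>: "0 < \<beta>" "\<beta> < real DIM('a)" and "z \<noteq> 0" "norm z \<le> r"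
  shows "riesz_const DIM('a) \<beta> * r powr (- (real DIM('a) - \<beta>)) \<le> riesz_kernel \<beta> z"
  using assms riesz_const_pos[OF \<beta>] unfolding riesz_kernel_def
  by (intro mult_left_mono powr_mono2') auto

text \<open>
  The dyadic shells \<open>r / 2\<^bsup>k+1\<^esup> \<le> t \<le> r / 2\<^sup>k\<close> cover \<open>(0, r]\<close>; they serve to bound the singularity of the
  kernel by a countable combination of indicators of balls.
\<close>

lemma dyadic_scale:
  fixes t r :: real
  assumes "0 < t" "t \<le> r"
  obtains k where "r * (1/2) ^ Suc k \<le> t" "t \<le> r * (1/2) ^ k"
proof -
  have r: "0 < r" using assms by simp
  \<comment> \<open>The first \<open>k\<close> at which the dyadic radius drops below \<open>t\<close> is positive, and its predecessor is the shell.\<close>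
  obtain n where n: "(1/2) ^ n < t / r"
    using real_arch_pow_inv[of "t / r" "1/2"] assms r by auto
  have "\<exists>k\<le>n. (\<forall>i<k. t \<le> r * (1/2) ^ i) \<and> r * (1/2) ^ k < t"
    by (rule ex_least_nat_le[where P = "\<lambda>k. r * (1/2) ^ k < t", unfolded not_less])
       (use n r assms in \<open>auto simp: field_simps\<close>)
  then obtain k where k: "\<forall>i<k. t \<le> r * (1/2) ^ i" "r * (1/2) ^ k < t"
    by blast
  have "k \<noteq> 0" using k(2) assms by (intro notI) simp
  then obtain j where "k = Suc j" by (cases k) auto
  with k show ?thesis by (intro that[of j]) auto
qed

text \<open>
  On the \<open>k\<close>-th dyadic shell the kernel is at most its value at the inner radius, and the ball of
  the outer radius has volume proportional to \<open>2\<^bsup>-kN\<^esup>\<close>. The product is a multiple of \<open>2\<^bsup>-k\<beta>\<^esup>\<close>, so the sum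
  over all shells is a geometric series, convergent because \<open>\<beta> > 0\<close>.
\<close>

lemma riesz_kernel_locally_integrable:
  assumes \<beta>: "0 < \<beta>" "\<beta> < real DIM('a::euclidean_space)" and r: "0 < r"
  shows "(\<integral>\<^sup>+x\<in>cball 0 r. ennreal (riesz_kernel \<beta> (x::'a)) \<partial>lborel) < \<infinity>"
proof -
  define d where "d = DIM('a)"
  define s where "s = real d - \<beta>"
  define c where "c = riesz_const d \<beta>"
  define v where "v = unit_ball_vol (real d)"
  define a where "a k = c * (r * (1/2) ^ Suc k) powr (- s)" for k
  have c: "0 < c" using riesz_const_pos[OF \<beta>] by (simp add: c_def d_def)
  have s: "0 < s" using \<beta> by (simp add: s_def d_def)
  have v: "0 \<le> v" by (simp add: v_def)
  have a: "0 \<le> a k" for k using c by (simp add: a_def)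
  have dom: "ennreal (riesz_kernel \<beta> x) * indicator (cball 0 r) x
      \<le> (\<Sum>k. ennreal (a k) * indicator (cball 0 (r * (1/2) ^ k)) x)" for x :: 'a
  proof (cases "x \<noteq> 0 \<and> norm x \<le> r")
    case True
    then obtain k where k: "r * (1/2) ^ Suc k \<le> norm x" "norm x \<le> r * (1/2) ^ k"
      using dyadic_scale[of "norm x" r] by auto
    have "norm x powr (- s) \<le> (r * (1/2) ^ Suc k) powr (- s)"
      using k s r by (intro powr_mono2') auto
    then have "riesz_kernel \<beta> x \<le> a k"
      using c by (simp add: riesz_kernel_def a_def c_def s_def d_def)
    then have "ennreal (riesz_kernel \<beta> x) * indicator (cball 0 r) x
        \<le> (\<Sum>k\<in>{k}. ennreal (a k) * indicator (cball 0 (r * (1/2) ^ k)) x)"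
      using k(2) True by (simp add: ennreal_leI)
    also have "\<dots> \<le> (\<Sum>k. ennreal (a k) * indicator (cball 0 (r * (1/2) ^ k)) x)"
      by (rule sum_le_suminf) auto
    finally show ?thesis .
  next
    case False
    then show ?thesis by (auto simp: riesz_kernel_def)
  qed
  have "(\<integral>\<^sup>+x\<in>cball 0 r. ennreal (riesz_kernel \<beta> (x::'a)) \<partial>lborel)
      \<le> (\<integral>\<^sup>+x. (\<Sum>k. ennreal (a k) * indicator (cball 0 (r * (1/2) ^ k)) (x::'a)) \<partial>lborel)"
    by (intro nn_integral_mono dom)
  also have "\<dots> = (\<Sum>k. ennreal (a k) * emeasure lborel (cball (0::'a) (r * (1/2) ^ k)))"
    by (subst nn_integral_suminf)
       (auto simp: nn_integral_cmult_indicator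
             intro!: borel_measurable_times_ennreal borel_measurable_indicator)
  also have "\<dots> = (\<Sum>k. ennreal (c * (r / 2) powr (- s) * v * r ^ d * ((1/2) powr \<beta>) ^ k))"
  proof (intro suminf_cong)
    fix k
    have h: "((1/2) ^ k) powr (- s) * ((1/2) ^ k) ^ d = ((1/2) powr \<beta>) ^ k" for k
    proof -
      have "((1/2::real) ^ k) powr (- s) * ((1/2) ^ k) ^ d
          = ((1/2) powr real k) powr (- s) * ((1/2) powr real k) powr real d"
        by (simp add: powr_realpow)
      also have "\<dots> = ((1/2) powr real k) powr (real d - s)"
        by (simp add: powr_add[symmetric])
      also have "\<dots> = ((1/2) powr \<beta>) ^ k"
        by (simp add: s_def powr_powr mult.commute powr_realpow[symmetric])
      finally show ?thesis .
    qed
    have "a k * (v * (r * (1/2) ^ k) ^ d)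
        = c * (r / 2) powr (- s) * v * r ^ d * (((1/2) ^ k) powr (- s) * ((1/2) ^ k) ^ d)"
    proof -
      have "(r * (1/2) ^ Suc k) powr (- s) = (r / 2) powr (- s) * ((1/2) ^ k) powr (- s)"
        using r by (subst powr_mult[symmetric]) auto
      then show ?thesis by (simp add: a_def power_mult_distrib)
    qed
    moreover have "emeasure lborel (cball (0::'a) (r * (1/2) ^ k)) = ennreal (v * (r * (1/2) ^ k) ^ d)"
      using r by (subst emeasure_cball) (auto simp: v_def d_def)
    ultimately show "ennreal (a k) * emeasure lborel (cball (0::'a) (r * (1/2) ^ k))
        = ennreal (c * (r / 2) powr (- s) * v * r ^ d * ((1/2) powr \<beta>) ^ k)"
      using a[of k] by (simp only: h ennreal_mult'[OF a, symmetric])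
  qed
  also have "\<dots> < \<infinity>"
  proof -
    have "summable (\<lambda>k. c * (r / 2) powr (- s) * v * r ^ d * ((1/2) powr \<beta>) ^ k)"
      using \<beta> powr_less_mono2[of \<beta> "1/2" 1] by (intro summable_mult summable_geometric) auto
    then show ?thesis
      using c r v by (subst suminf_ennreal2) auto
  qed
  finally show ?thesis .
qed


section \<open>Null sequences in the extended half-line\<close>

lemma ennreal_tendsto_0I:
  assumes "\<And>e::real. 0 < e \<Longrightarrow> eventually (\<lambda>n. f n \<le> ennreal e) F"
  shows "(f \<longlongrightarrow> 0) F"
proof (rule order_tendstoI)
  fix a :: ennreal assume "0 < a"
  then obtain e :: real where e: "0 < e" "ennreal e < a"
    by (metis dense ennreal_0 ennreal_cases ennreal_less_iff le_numeral_extra(3) not_less_iff_gr_or_eq top.not_eq_extremum top.extremum_strict)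
  from assms[OF e(1)] show "eventually (\<lambda>n. f n < a) F"
    by eventually_elim (use e in auto)
qed auto

lemma ennreal_tendsto_0D:
  assumes "(f \<longlongrightarrow> 0) F" "0 < (e::real)"
  shows "eventually (\<lambda>n. f n \<le> ennreal e) F"
  using order_tendstoD(2)[OF assms(1), of "ennreal e"] assms(2)
  by (auto elim!: eventually_mono simp: ennreal_zero_less_divide)

lemma ennreal_tendsto_0_le:
  fixes f g :: "'b \<Rightarrow> ennreal"
  assumes "(g \<longlongrightarrow> 0) F" "\<And>n. f n \<le> g n"
  shows "(f \<longlongrightarrow> 0) F"
  by (rule tendsto_sandwich[OF _ _ tendsto_const assms(1)]) (use assms(2) in auto)

lemma ennreal_tendsto_0_cmult:
  fixes g :: "'b \<Rightarrow> ennreal"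
  assumes "(g \<longlongrightarrow> 0) F" "c < \<infinity>"
  shows "((\<lambda>n. c * g n) \<longlongrightarrow> 0) F"
  using ennreal_tendsto_cmult[of c g 0 F] assms by simp

lemma ennreal_tendsto_0_mult_cancel:
  fixes a c :: "'b \<Rightarrow> ennreal"
  assumes c: "(c \<longlongrightarrow> 0) F" and b: "b \<noteq> 0" and le: "\<And>n. b * a n \<le> c n"
  shows "(a \<longlongrightarrow> 0) F"
proof (rule ennreal_tendsto_0I)
  fix e :: real assume e: "0 < e"
  obtain b' :: real where b': "0 < b'" "ennreal b' \<le> b"
    using b by (cases b rule: ennreal_cases) (auto intro: that[of 1] simp: less_le)
  have "eventually (\<lambda>n. c n \<le> ennreal (b' * e)) F"
    using b' e by (intro ennreal_tendsto_0D[OF c]) auto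
  then show "eventually (\<lambda>n. a n \<le> ennreal e) F"
  proof eventually_elim
    case (elim n)
    have "ennreal b' * a n \<le> b * a n" using b' by (intro mult_right_mono) auto
    also have "\<dots> \<le> ennreal (b' * e)" using le[of n] elim by simp
    also have "\<dots> = ennreal b' * ennreal e" using b' e by (simp add: ennreal_mult)
    finally show ?case using b' by (subst (asm) ennreal_mult_le_mult_iff) auto
  qed
qed

lemma ennreal_power2_le_imp_le:
  fixes t :: ennreal
  assumes "t\<^sup>2 \<le> ennreal (d\<^sup>2)" "0 \<le> d"
  shows "t \<le> ennreal d"
proof (cases t rule: ennreal_cases)
  case (real r)
  with assms have "r\<^sup>2 \<le> d\<^sup>2" by (simp add: ennreal_power)
  then show ?thesis using assms real by (auto intro!: ennreal_leI power2_le_imp_le)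
next
  case top
  with assms show ?thesis by (simp add: power2_eq_square top_unique)
qed

section \<open>The Riesz potential of a nonnegative function\<close>

text \<open>
  The operator acts on functions with values in \<open>[0, \<infinity>]\<close>: there it is additive and monotone
  without any integrability hypothesis, and Tonelli's theorem applies.
\<close>

definition riesz_op :: "real \<Rightarrow> ('a::euclidean_space \<Rightarrow> ennreal) \<Rightarrow> 'a \<Rightarrow> ennreal" where
  "riesz_op \<beta> h x = (\<integral>\<^sup>+y. ennreal (riesz_kernel \<beta> (x - y)) * h y \<partial>lebesgue)"

lemma riesz_conv_eq_riesz_op:
  fixes f :: "'a::euclidean_space \<Rightarrow> real"
  assumes "0 < \<beta>" "\<beta> < real DIM('a)"
  shows "riesz_conv \<beta> f = riesz_op \<beta> (\<lambda>y. ennreal (f y))"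
  by (auto simp: fun_eq_iff riesz_conv_def riesz_op_def ennreal_mult' riesz_kernel_nonneg[OF assms])

lemma sigma_finite_lebesgue: "sigma_finite_measure (lebesgue :: 'a::euclidean_space measure)"
proof
  obtain A :: "'a set set" where "countable A" "A \<subseteq> sets lborel" "\<Union>A = space lborel"
      "\<forall>a\<in>A. emeasure lborel a \<noteq> \<infinity>"
    using lborel.sigma_finite_countable by metis
  then show "\<exists>A::'a set set. countable A \<and> A \<subseteq> sets lebesgue \<and> \<Union>A = space lebesgue \<and>
      (\<forall>a\<in>A. emeasure lebesgue a \<noteq> \<infinity>)"
    by (intro exI[of _ A]) (auto simp: subset_iff)
qed

lemma measurable_ident_lebesgue_borel [measurable]: "(\<lambda>x. x) \<in> lebesgue \<rightarrow>\<^sub>M borel"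
  by (simp add: measurable_completion)

text \<open>
  Measurability has to hold jointly although \<open>h\<close> is only Lebesgue measurable. The kernel is Borel, so
  it suffices to complete the measure in the variable \<open>y\<close>, and the product with the sigma-finite
  measure \<^const>\<open>lebesgue\<close> then gives a Borel function of \<open>x\<close>.
\<close>

lemma measurable_riesz_integrand:
  fixes h :: "'a::euclidean_space \<Rightarrow> ennreal"
  assumes [measurable]: "h \<in> borel_measurable lebesgue"
  shows "(\<lambda>(x, y). ennreal (riesz_kernel \<beta> (x - y)) * h y)
    \<in> borel_measurable (lborel \<Otimes>\<^sub>M lebesgue)"
proof -
  have [measurable]: "snd \<in> lborel \<Otimes>\<^sub>M lebesgue \<rightarrow>\<^sub>M (borel :: 'a measure)"
    by (rule measurable_compose[OF measurable_snd measurable_ident_lebesgue_borel])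
  have [measurable]: "fst \<in> lborel \<Otimes>\<^sub>M (lebesgue :: 'a measure) \<rightarrow>\<^sub>M (borel :: 'a measure)"
    using measurable_fst[of "lborel :: 'a measure" "lebesgue :: 'a measure"] by simp
  have "(\<lambda>z. h (snd z)) \<in> borel_measurable ((lborel :: 'a measure) \<Otimes>\<^sub>M lebesgue)"
    by (rule measurable_compose[OF measurable_snd assms])
  then show ?thesis unfolding case_prod_unfold by measurable
qed

lemma borel_measurable_riesz_op:
  fixes h :: "'a::euclidean_space \<Rightarrow> ennreal"
  assumes "h \<in> borel_measurable lebesgue"
  shows "riesz_op \<beta> h \<in> borel_measurable borel"
  using sigma_finite_measure.borel_measurable_nn_integral[OF sigma_finite_lebesgue
      measurable_riesz_integrand[OF assms, of \<beta>]]
  unfolding riesz_op_def[abs_def] by simp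

lemma borel_measurable_riesz_op_lebesgue [measurable]:
  fixes h :: "'a::euclidean_space \<Rightarrow> ennreal"
  assumes "h \<in> borel_measurable lebesgue"
  shows "riesz_op \<beta> h \<in> borel_measurable lebesgue"
  using borel_measurable_riesz_op[OF assms] by (simp add: measurable_completion)

lemma borel_measurable_riesz_integrand_right [measurable]:
  fixes x :: "'a::euclidean_space"
  shows "(\<lambda>y. ennreal (riesz_kernel \<beta> (x - y))) \<in> borel_measurable lebesgue"
  by (rule measurable_completion) simp

lemma riesz_op_mono_AE:
  assumes "AE y in lebesgue. g y \<le> h y"
  shows "riesz_op \<beta> g x \<le> riesz_op \<beta> h x"
  unfolding riesz_op_def using assms
  by (intro nn_integral_mono_AE) (auto elim!: eventually_mono intro: mult_left_mono)

lemma riesz_op_add: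
  fixes g h :: "'a::euclidean_space \<Rightarrow> ennreal"
  assumes [measurable]: "g \<in> borel_measurable lebesgue" "h \<in> borel_measurable lebesgue"
  shows "riesz_op \<beta> (\<lambda>y. g y + h y) x = riesz_op \<beta> g x + riesz_op \<beta> h x"
  unfolding riesz_op_def by (simp add: distrib_left nn_integral_add)

lemma riesz_op_cmult:
  fixes h :: "'a::euclidean_space \<Rightarrow> ennreal"
  assumes [measurable]: "h \<in> borel_measurable lebesgue"
  shows "riesz_op \<beta> (\<lambda>y. c * h y) x = c * riesz_op \<beta> h x"
  unfolding riesz_op_def by (simp add: nn_integral_cmult mult.left_commute)

lemma sets_cball_lebesgue [measurable]: "cball x r \<in> sets lebesgue"
  by simp

text \<open>
  Points of the ball of radius \<open>r\<close> are at distance at most \<open>2 r\<close> from each other, and the kernel is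
  bounded below by its value there. Only the point \<open>y = x\<close>, where the kernel is \<open>0\<close>, is exceptional.
\<close>

lemma riesz_op_lower:
  fixes h :: "'a::euclidean_space \<Rightarrow> ennreal"
  assumes \<beta>: "0 < \<beta>" "\<beta> < real DIM('a)" and h [measurable]: "h \<in> borel_measurable lebesgue"
    and x: "norm x \<le> r"
  shows "ennreal (riesz_const DIM('a) \<beta> * (2 * r) powr (- (real DIM('a) - \<beta>)))
      * (\<integral>\<^sup>+y\<in>cball 0 r. h y \<partial>lebesgue) \<le> riesz_op \<beta> h x"
proof -
  let ?k = "riesz_const DIM('a) \<beta> * (2 * r) powr (- (real DIM('a) - \<beta>))"
  have "AE y in lebesgue. y \<noteq> x"
    by (intro AE_completion AE_lborel_singleton)
  then have "(\<integral>\<^sup>+y. ennreal ?k * (h y * indicator (cball 0 r) y) \<partial>lebesgue) \<le> riesz_op \<beta> h x"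
    unfolding riesz_op_def
  proof (intro nn_integral_mono_AE, eventually_elim)
    case (elim y)
    show ?case
    proof (cases "norm y \<le> r")
      case True
      have "norm (x - y) \<le> 2 * r" using x True norm_triangle_ineq4[of x y] by simp
      then have "ennreal ?k \<le> ennreal (riesz_kernel \<beta> (x - y))"
        using elim by (intro ennreal_leI riesz_kernel_lower[OF \<beta>]) auto
      then show ?thesis
        using True by (simp add: mult_right_mono del: minus_diff_eq)
    qed auto
  qed
  then show ?thesis by (simp add: nn_integral_cmult)
qed

text \<open>
  For \<open>|y| > R\<close> all distances from \<open>y\<close> to points of the ball of radius \<open>R\<close> are at most
  \<open>2 |y|\<close>, whereas a point \<open>z\<close> with \<open>|z| \<le> R/2\<close> is at distance at least \<open>|y|/2\<close>. So the ratio of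
  distances is at most \<open>4\<close>, and the potential of the outer part at \<open>z\<close> is controlled by the potential at
  every point of the large ball.
\<close>

lemma riesz_op_tail:
  fixes h :: "'a::euclidean_space \<Rightarrow> ennreal"
  assumes \<beta>: "0 < \<beta>" "\<beta> < real DIM('a)" and h [measurable]: "h \<in> borel_measurable lebesgue"
    and z: "norm z \<le> r" and x: "norm x \<le> R" and r: "0 < r" "2 * r \<le> R"
  shows "riesz_op \<beta> (\<lambda>y. h y * indicator (- cball 0 R) y) z
      \<le> ennreal (4 powr (real DIM('a) - \<beta>)) * riesz_op \<beta> h x"
proof -
  have "riesz_op \<beta> (\<lambda>y. h y * indicator (- cball 0 R) y) z
      \<le> (\<integral>\<^sup>+y. ennreal (4 powr (real DIM('a) - \<beta>)) * (ennreal (riesz_kernel \<beta> (x - y)) * h y) \<partial>lebesgue)"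
    unfolding riesz_op_def
  proof (intro nn_integral_mono)
    fix y :: 'a
    show "ennreal (riesz_kernel \<beta> (z - y)) * (h y * indicator (- cball 0 R) y)
        \<le> ennreal (4 powr (real DIM('a) - \<beta>)) * (ennreal (riesz_kernel \<beta> (x - y)) * h y)"
    proof (cases "norm y \<le> R")
      case False
      have "norm (x - y) \<le> norm x + norm y" "norm y \<le> norm z + norm (z - y)"
        using norm_triangle_ineq4[of x y] norm_triangle_sub[of y z] by (auto simp: norm_minus_commute)
      with False z x r have "norm (x - y) \<le> 4 * norm (z - y)" by simp
      moreover have "x - y \<noteq> 0" using False x by auto
      ultimately have "riesz_kernel \<beta> (z - y) \<le> 4 powr (real DIM('a) - \<beta>) * riesz_kernel \<beta> (x - y)"
        by (intro riesz_kernel_compare[OF \<beta>]) auto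
      then have "ennreal (riesz_kernel \<beta> (z - y))
          \<le> ennreal (4 powr (real DIM('a) - \<beta>)) * ennreal (riesz_kernel \<beta> (x - y))"
        by (simp add: ennreal_mult'[symmetric] ennreal_leI)
      then show ?thesis using False
        by (auto simp: mult.assoc[symmetric] intro: mult_right_mono)
    qed auto
  qed
  then show ?thesis by (simp add: riesz_op_def nn_integral_cmult)
qed

text \<open>
  Tonelli's theorem moves the integration over the ball onto the kernel. For \<open>x\<close> and \<open>y\<close> in the
  two balls, \<open>x - y\<close> lies in the ball of radius \<open>r + R\<close>.
\<close>

lemma riesz_op_local:
  fixes h :: "'a::euclidean_space \<Rightarrow> ennreal"
  assumes \<beta>: "0 < \<beta>" "\<beta> < real DIM('a)" and h [measurable]: "h \<in> borel_measurable lebesgue"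
  shows "(\<integral>\<^sup>+x\<in>cball 0 r. riesz_op \<beta> (\<lambda>y. h y * indicator (cball 0 R) y) x \<partial>lebesgue)
      \<le> (\<integral>\<^sup>+x\<in>cball 0 (r + R). ennreal (riesz_kernel \<beta> (x::'a)) \<partial>lborel)
        * (\<integral>\<^sup>+y\<in>cball 0 R. h y \<partial>lebesgue)"
    (is "_ \<le> ?M * _")
proof -
  let ?g = "\<lambda>y. h y * indicator (cball 0 R) y"
  let ?k = "\<lambda>x y. ennreal (riesz_kernel \<beta> (x - y)) * ?g y * indicator (cball 0 r) x"
  interpret P: pair_sigma_finite "lborel :: 'a measure" "lebesgue :: 'a measure"
    by (intro pair_sigma_finite.intro sigma_finite_lebesgue sigma_finite_lborel)
  have g [measurable]: "?g \<in> borel_measurable lebesgue" by measurable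
  have "(\<lambda>x. ennreal (riesz_kernel \<beta> x) * indicator (cball 0 (r + R)) x) \<in> borel_measurable (borel :: 'a measure)"
    by (auto intro!: borel_measurable_times_ennreal borel_measurable_indicator)
  then have K: "(\<lambda>x. ennreal (riesz_kernel \<beta> (x - y)) * indicator (cball 0 (r + R)) (x - y))
      \<in> borel_measurable lborel" for y :: 'a
    using measurable_compose[of "\<lambda>x. x - y" lborel borel] by simp
  have ind: "(\<lambda>z. indicator (cball 0 r) (fst z) :: ennreal)
      \<in> borel_measurable ((lborel::'a measure) \<Otimes>\<^sub>M (lebesgue::'a measure))"
    by (rule measurable_compose[OF measurable_fst]) (auto intro!: borel_measurable_indicator)
  have k: "case_prod ?k \<in> borel_measurable (lborel \<Otimes>\<^sub>M lebesgue)"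
    using borel_measurable_times_ennreal[OF measurable_riesz_integrand[OF g, of \<beta>] ind]
    by (simp only: case_prod_unfold)
  have "(\<integral>\<^sup>+x\<in>cball 0 r. riesz_op \<beta> ?g x \<partial>lebesgue) = (\<integral>\<^sup>+x. \<integral>\<^sup>+y. ?k x y \<partial>lebesgue \<partial>lborel)"
    unfolding riesz_op_def by (subst nn_integral_completion) (simp add: nn_integral_multc)
  also have "\<dots> = (\<integral>\<^sup>+y. \<integral>\<^sup>+x. ?k x y \<partial>lborel \<partial>lebesgue)"
    using P.Fubini'[OF k] by simp
  also have "\<dots> \<le> (\<integral>\<^sup>+y. ?M * ?g y \<partial>lebesgue)"
  proof (intro nn_integral_mono)
    fix y :: 'a
    have "(\<integral>\<^sup>+x. ?k x y \<partial>lborel)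
        \<le> (\<integral>\<^sup>+x. ennreal (riesz_kernel \<beta> (x - y)) * indicator (cball 0 (r + R)) (x - y) * ?g y \<partial>lborel)"
    proof (intro nn_integral_mono)
      fix x :: 'a
      show "?k x y \<le> ennreal (riesz_kernel \<beta> (x - y)) * indicator (cball 0 (r + R)) (x - y) * ?g y"
        using norm_triangle_ineq4[of x y] by (auto split: split_indicator)
    qed
    also have "\<dots> = (\<integral>\<^sup>+x. ennreal (riesz_kernel \<beta> (x - y)) * indicator (cball 0 (r + R)) (x - y) \<partial>lborel) * ?g y"
      by (intro nn_integral_multc K)
    also have "(\<integral>\<^sup>+x. ennreal (riesz_kernel \<beta> (x - y)) * indicator (cball 0 (r + R)) (x - y) \<partial>lborel) = ?M"
      by (subst (2) lborel_distr_plus[symmetric, of "- y"])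
         (subst nn_integral_distr, use K[of 0] in simp_all)
    finally show "(\<integral>\<^sup>+x. ?k x y \<partial>lborel) \<le> ?M * ?g y" .
  qed
  also have "\<dots> = ?M * (\<integral>\<^sup>+y. ?g y \<partial>lebesgue)"
    by (intro nn_integral_cmult) measurable
  finally show ?thesis .
qed

section \<open>Weakly null sequences of potentials\<close>

text \<open>
  The square of the tail, multiplied by the volume of the ball of radius \<open>R\<close>, is bounded by a
  multiple of the squared \<open>L\<^sup>2\<close> norm of the potential. As the volume grows with \<open>R\<close>, the tail is small
  uniformly over all \<open>h\<close> whose potentials obey the same \<open>L\<^sup>2\<close> bound.
\<close>

lemma riesz_op_tail_uniform:
  assumes \<beta>: "0 < \<beta>" "\<beta> < real DIM('a::euclidean_space)" and r: "0 < r" and \<delta>: "0 < \<delta>" and C: "0 \<le> C"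
  obtains R where "0 < R" "2 * r \<le> R"
    "\<And>(h :: 'a \<Rightarrow> ennreal) z. h \<in> borel_measurable lebesgue \<Longrightarrow>
      (\<integral>\<^sup>+x. (riesz_op \<beta> h x)\<^sup>2 \<partial>lebesgue) \<le> ennreal C \<Longrightarrow> norm z \<le> r \<Longrightarrow>
      riesz_op \<beta> (\<lambda>y. h y * indicator (- cball 0 R) y) z \<le> ennreal \<delta>"
proof -
  define q where "q = 4 powr (real DIM('a) - \<beta>)"
  define v where "v = unit_ball_vol (real DIM('a))"
  \<comment> \<open>The last entry makes \<open>\<delta>\<^sup>2 |B\<^sub>R|\<close> at least \<open>q\<^sup>2 C\<close>; the entry \<open>1\<close> ensures \<open>R \<le> R\<^sup>N\<close>.\<close>
  define R where "R = Max {2 * r, 1, q\<^sup>2 * C / (v * \<delta>\<^sup>2)}"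
  have v: "0 < v" by (simp add: v_def)
  have R: "2 * r \<le> R" "1 \<le> R" "q\<^sup>2 * C / (v * \<delta>\<^sup>2) \<le> R"
    by (auto simp: R_def)
  have vol: "q\<^sup>2 * C \<le> \<delta>\<^sup>2 * (v * R ^ DIM('a))"
  proof -
    have "q\<^sup>2 * C \<le> (v * \<delta>\<^sup>2) * R" using R(3) v \<delta> by (simp add: field_simps)
    also have "\<dots> \<le> (v * \<delta>\<^sup>2) * R ^ DIM('a)"
      using R(2) v by (intro mult_left_mono self_le_power) auto
    finally show ?thesis by (simp add: mult_ac)
  qed
  have ball: "emeasure lebesgue (cball (0::'a) R) = ennreal (v * R ^ DIM('a))"
    using R(2) emeasure_cball[of R "0::'a"] by (simp add: v_def)
  have "riesz_op \<beta> (\<lambda>y. h y * indicator (- cball 0 R) y) z \<le> ennreal \<delta>"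
    if h [measurable]: "h \<in> borel_measurable lebesgue"
      and le: "(\<integral>\<^sup>+x. (riesz_op \<beta> h x)\<^sup>2 \<partial>lebesgue) \<le> ennreal C" and z: "norm z \<le> r"
    for h :: "'a \<Rightarrow> ennreal" and z
  proof -
    define t where "t = riesz_op \<beta> (\<lambda>y. h y * indicator (- cball 0 R) y) z"
    have "ennreal (v * R ^ DIM('a)) * t\<^sup>2 = (\<integral>\<^sup>+x. t\<^sup>2 * indicator (cball 0 R) (x::'a) \<partial>lebesgue)"
      by (subst nn_integral_cmult_indicator) (simp_all only: ball sets_cball_lebesgue mult.commute)
    also have "\<dots> \<le> (\<integral>\<^sup>+x. ennreal (q\<^sup>2) * (riesz_op \<beta> h x)\<^sup>2 \<partial>lebesgue)"
    proof (intro nn_integral_mono)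
      fix x :: 'a
      show "t\<^sup>2 * indicator (cball 0 R) x \<le> ennreal (q\<^sup>2) * (riesz_op \<beta> h x)\<^sup>2"
      proof (cases "norm x \<le> R")
        case True
        have "t \<le> ennreal q * riesz_op \<beta> h x"
          unfolding t_def q_def using True R r z by (intro riesz_op_tail[OF \<beta> h]) auto
        then have "t\<^sup>2 \<le> (ennreal q * riesz_op \<beta> h x)\<^sup>2"
          by (rule power_mono_ennreal)
        with True show ?thesis by (simp add: power_mult_distrib ennreal_power q_def)
      qed auto
    qed
    also have "\<dots> = ennreal (q\<^sup>2) * (\<integral>\<^sup>+x. (riesz_op \<beta> h x)\<^sup>2 \<partial>lebesgue)"
      by (intro nn_integral_cmult) measurable
    also have "\<dots> \<le> ennreal (q\<^sup>2) * ennreal C"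
      by (intro mult_left_mono le) simp
    also have "\<dots> \<le> ennreal (v * R ^ DIM('a)) * ennreal (\<delta>\<^sup>2)"
      using vol v R C by (simp add: ennreal_mult[symmetric] ennreal_leI mult_ac)
    finally have "t\<^sup>2 \<le> ennreal (\<delta>\<^sup>2)"
      using v R by (subst (asm) ennreal_mult_le_mult_iff) auto
    then show ?thesis unfolding t_def by (rule ennreal_power2_le_imp_le) (use \<delta> in simp)
  qed
  then show ?thesis using R by (intro that[of R]) auto
qed

text \<open>
  The part of \<open>h n\<close> inside a large ball is handled by local integrability of the kernel, the part
  outside by the uniform tail estimate.
\<close>

lemma riesz_op_null_on_balls:
  fixes h :: "nat \<Rightarrow> 'a::euclidean_space \<Rightarrow> ennreal"
  assumes \<beta>: "0 < \<beta>" "\<beta> < real DIM('a)"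
    and h [measurable]: "\<And>n. h n \<in> borel_measurable lebesgue"
    and C: "0 \<le> C" "\<And>n. (\<integral>\<^sup>+x. (riesz_op \<beta> (h n) x)\<^sup>2 \<partial>lebesgue) \<le> ennreal C"
    and loc: "\<And>R. 0 < R \<Longrightarrow> (\<lambda>n. \<integral>\<^sup>+y\<in>cball 0 R. h n y \<partial>lebesgue) \<longlonglongrightarrow> 0"
    and r: "0 < r"
  shows "(\<lambda>n. \<integral>\<^sup>+x\<in>cball 0 r. riesz_op \<beta> (h n) x \<partial>lebesgue) \<longlonglongrightarrow> 0"
proof (rule ennreal_tendsto_0I)
  fix e :: real assume e: "0 < e"
  define b where "b = measure lebesgue (cball (0::'a) r)"
  have ball: "emeasure lebesgue (cball (0::'a) r) = ennreal b"
    unfolding b_def by (intro emeasure_eq_ennreal_measure) (use emeasure_lborel_cball_finite[of "0::'a" r] in simp)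
  have b: "0 \<le> b" by (simp add: b_def)
  define \<delta> where "\<delta> = e / (2 * (b + 1))"
  have \<delta>: "0 < \<delta>" "\<delta> * b \<le> e / 2" using e b by (auto simp: \<delta>_def field_simps)
  obtain R where R: "0 < R" "2 * r \<le> R"
    "\<And>(h :: 'a \<Rightarrow> ennreal) z. h \<in> borel_measurable lebesgue \<Longrightarrow>
      (\<integral>\<^sup>+x. (riesz_op \<beta> h x)\<^sup>2 \<partial>lebesgue) \<le> ennreal C \<Longrightarrow> norm z \<le> r \<Longrightarrow>
      riesz_op \<beta> (\<lambda>y. h y * indicator (- cball 0 R) y) z \<le> ennreal \<delta>"
    using riesz_op_tail_uniform[OF \<beta> r \<delta>(1) C(1)] by blast
  define M where "M = (\<integral>\<^sup>+x\<in>cball 0 (r + R). ennreal (riesz_kernel \<beta> (x::'a)) \<partial>lborel)"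
  have M: "M < \<infinity>" unfolding M_def using r R by (intro riesz_kernel_locally_integrable[OF \<beta>]) auto
  have "(\<lambda>n. M * (\<integral>\<^sup>+y\<in>cball 0 R. h n y \<partial>lebesgue)) \<longlonglongrightarrow> 0"
    by (intro ennreal_tendsto_0_cmult loc R M)
  from ennreal_tendsto_0D[OF this, of "e / 2"] e
  have "eventually (\<lambda>n. M * (\<integral>\<^sup>+y\<in>cball 0 R. h n y \<partial>lebesgue) \<le> ennreal (e / 2)) sequentially"
    by simp
  then show "eventually (\<lambda>n. (\<integral>\<^sup>+x\<in>cball 0 r. riesz_op \<beta> (h n) x \<partial>lebesgue) \<le> ennreal e) sequentially"
  proof eventually_elim
    case (elim n)
    let ?i = "\<lambda>y. h n y * indicator (cball 0 R) y" and ?o = "\<lambda>y. h n y * indicator (- cball 0 R) y"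
    have [measurable]: "?i \<in> borel_measurable lebesgue" "?o \<in> borel_measurable lebesgue"
      by measurable
    have "(\<integral>\<^sup>+x\<in>cball 0 r. riesz_op \<beta> (h n) x \<partial>lebesgue)
        = (\<integral>\<^sup>+x\<in>cball 0 r. (riesz_op \<beta> ?i x + riesz_op \<beta> ?o x) \<partial>lebesgue)"
    proof -
      have "h n = (\<lambda>y. ?i y + ?o y)" by (auto simp: fun_eq_iff split: split_indicator)
      then show ?thesis by (subst riesz_op_add[symmetric]) auto
    qed
    also have "\<dots> = (\<integral>\<^sup>+x\<in>cball 0 r. riesz_op \<beta> ?i x \<partial>lebesgue)
        + (\<integral>\<^sup>+x\<in>cball 0 r. riesz_op \<beta> ?o x \<partial>lebesgue)"
      unfolding distrib_right by (rule nn_integral_add) measurable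
    also have "(\<integral>\<^sup>+x\<in>cball 0 r. riesz_op \<beta> ?o x \<partial>lebesgue)
        \<le> (\<integral>\<^sup>+x\<in>cball (0::'a) r. ennreal \<delta> \<partial>lebesgue)"
      using R(3)[OF h C(2)] by (intro nn_integral_mono) (auto split: split_indicator)
    also have "\<dots> \<le> ennreal (e / 2)"
      using \<delta> b by (simp add: ball ennreal_mult[symmetric] ennreal_leI nn_integral_cmult_indicator)
    also have "(\<integral>\<^sup>+x\<in>cball 0 r. riesz_op \<beta> ?i x \<partial>lebesgue) \<le> ennreal (e / 2)"
      using riesz_op_local[OF \<beta> h[of n], of R r] elim unfolding M_def by (rule order.trans)
    finally show ?case
      using e by (simp add: add_mono ennreal_plus[symmetric] del: ennreal_plus)
  qed
qed

text \<open>
  A square-integrable \<open>G\<close> is approximated in \<open>L\<^sup>2\<close> by its restriction to the set where both \<open>|x|\<close> and \<open>G x\<close> are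
  at most \<open>k\<close>. The restriction is bounded by \<open>k\<close> times the indicator of a ball, and the rest
  contributes little uniformly in \<open>n\<close> by the Cauchy--Schwarz inequality.
\<close>

lemma riesz_op_weakly_null:
  fixes h :: "nat \<Rightarrow> 'a::euclidean_space \<Rightarrow> ennreal" and G :: "'a \<Rightarrow> ennreal"
  assumes \<beta>: "0 < \<beta>" "\<beta> < real DIM('a)"
    and h [measurable]: "\<And>n. h n \<in> borel_measurable lebesgue"
    and C: "0 \<le> C" "\<And>n. (\<integral>\<^sup>+x. (riesz_op \<beta> (h n) x)\<^sup>2 \<partial>lebesgue) \<le> ennreal C"
    and loc: "\<And>R. 0 < R \<Longrightarrow> (\<lambda>n. \<integral>\<^sup>+y\<in>cball 0 R. h n y \<partial>lebesgue) \<longlonglongrightarrow> 0"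
    and G [measurable]: "G \<in> borel_measurable lebesgue" and G2: "(\<integral>\<^sup>+x. (G x)\<^sup>2 \<partial>lebesgue) < \<infinity>"
  shows "(\<lambda>n. \<integral>\<^sup>+x. G x * riesz_op \<beta> (h n) x \<partial>lebesgue) \<longlonglongrightarrow> 0"
proof (rule ennreal_tendsto_0I)
  fix e :: real assume e: "0 < e"
  define A where "A k = {x :: 'a. x \<in> cball 0 (real k) \<and> G x \<le> of_nat k}" for k
  have [measurable]: "A k \<in> sets lebesgue" for k
  proof -
    have "{x \<in> space lebesgue. G x \<le> of_nat k} \<in> sets lebesgue" by measurable
    moreover have "A k = cball 0 (real k) \<inter> {x \<in> space lebesgue. G x \<le> of_nat k}"
      by (auto simp: A_def)
    ultimately show ?thesis by simp
  qed
  have "(\<lambda>k. \<integral>\<^sup>+x. (G x * indicator (- A k) x)\<^sup>2 \<partial>lebesgue) \<longlonglongrightarrow> (\<integral>\<^sup>+x. 0 \<partial>(lebesgue :: 'a measure))"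
  proof (rule nn_integral_dominated_convergence[where w = "\<lambda>x. (G x)\<^sup>2"])
    have "AE x in lebesgue. (G x)\<^sup>2 \<noteq> \<infinity>"
      using G2 by (intro nn_integral_noteq_infinite) auto
    then show "AE x in lebesgue. (\<lambda>k. (G x * indicator (- A k) x)\<^sup>2) \<longlonglongrightarrow> 0"
    proof eventually_elim
      case (elim x)
      then have "G x < \<infinity>" by (auto simp: less_top[symmetric])
      then obtain g where g: "G x = ennreal g" "0 \<le> g" by (cases "G x") auto
      obtain m :: nat where m: "max (norm x) g \<le> real m" using real_arch_simple by blast
      have "eventually (\<lambda>k. (G x * indicator (- A k) x)\<^sup>2 = 0) sequentially"
        using eventually_ge_at_top[of m]
      proof eventually_elim
        case (elim k)
        then have "real m \<le> real k" by simp
        with m have "norm x \<le> real k" "g \<le> real k" by auto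
        then have "x \<in> A k" using g by (auto simp: A_def ennreal_of_nat_eq_real_of_nat ennreal_leI)
        then show ?case by simp
      qed
      then show ?case by (rule tendsto_eventually)
    qed
  qed (use G2 in \<open>auto split: split_indicator\<close>)
  then have "(\<lambda>k. \<integral>\<^sup>+x. (G x * indicator (- A k) x)\<^sup>2 \<partial>lebesgue) \<longlonglongrightarrow> 0" by simp
  from ennreal_tendsto_0D[OF this, of "(e / 2)\<^sup>2 / (C + 1)"]
  obtain k where k: "(\<integral>\<^sup>+x. (G x * indicator (- A k) x)\<^sup>2 \<partial>lebesgue) \<le> ennreal ((e / 2)\<^sup>2 / (C + 1))"
    using e C(1) by (auto simp: eventually_sequentially)
  define r where "r = real k + 1"
  have "(\<lambda>n. of_nat k * (\<integral>\<^sup>+x\<in>cball 0 r. riesz_op \<beta> (h n) x \<partial>lebesgue)) \<longlonglongrightarrow> 0"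
    by (intro ennreal_tendsto_0_cmult riesz_op_null_on_balls[OF \<beta> h C loc])
       (auto simp: r_def ennreal_of_nat_eq_real_of_nat)
  from ennreal_tendsto_0D[OF this, of "e / 2"] e
  have "eventually (\<lambda>n. of_nat k * (\<integral>\<^sup>+x\<in>cball 0 r. riesz_op \<beta> (h n) x \<partial>lebesgue) \<le> ennreal (e / 2))
      sequentially" by simp
  then show "eventually (\<lambda>n. (\<integral>\<^sup>+x. G x * riesz_op \<beta> (h n) x \<partial>lebesgue) \<le> ennreal e) sequentially"
  proof eventually_elim
    case (elim n)
    have "(\<integral>\<^sup>+x. G x * riesz_op \<beta> (h n) x \<partial>lebesgue)
        = (\<integral>\<^sup>+x. (G x * indicator (A k) x * riesz_op \<beta> (h n) x
              + G x * indicator (- A k) x * riesz_op \<beta> (h n) x) \<partial>lebesgue)"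
      by (intro nn_integral_cong) (auto split: split_indicator)
    also have "\<dots> = (\<integral>\<^sup>+x. G x * indicator (A k) x * riesz_op \<beta> (h n) x \<partial>lebesgue)
        + (\<integral>\<^sup>+x. G x * indicator (- A k) x * riesz_op \<beta> (h n) x \<partial>lebesgue)"
      by (rule nn_integral_add) measurable
    also have "(\<integral>\<^sup>+x. G x * indicator (A k) x * riesz_op \<beta> (h n) x \<partial>lebesgue)
        \<le> (\<integral>\<^sup>+x. of_nat k * (riesz_op \<beta> (h n) x * indicator (cball 0 r) x) \<partial>lebesgue)"
      by (intro nn_integral_mono) (auto simp: A_def r_def split: split_indicator intro: mult_right_mono)
    also have "\<dots> = of_nat k * (\<integral>\<^sup>+x\<in>cball 0 r. riesz_op \<beta> (h n) x \<partial>lebesgue)"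
      by (intro nn_integral_cmult) measurable
    also have "\<dots> \<le> ennreal (e / 2)" by (rule elim)
    also have "(\<integral>\<^sup>+x. G x * indicator (- A k) x * riesz_op \<beta> (h n) x \<partial>lebesgue) \<le> ennreal (e / 2)"
    proof (rule ennreal_power2_le_imp_le)
      have "(\<integral>\<^sup>+x. G x * indicator (- A k) x * riesz_op \<beta> (h n) x \<partial>lebesgue)\<^sup>2
          \<le> (\<integral>\<^sup>+x. (G x * indicator (- A k) x)\<^sup>2 \<partial>lebesgue) * (\<integral>\<^sup>+x. (riesz_op \<beta> (h n) x)\<^sup>2 \<partial>lebesgue)"
        by (rule Cauchy_Schwarz_nn_integral) measurable
      also have "\<dots> \<le> ennreal ((e / 2)\<^sup>2 / (C + 1)) * ennreal C"
        by (intro mult_mono k C) auto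
      also have "\<dots> \<le> ennreal ((e / 2)\<^sup>2)"
        using C(1) e by (simp add: ennreal_mult[symmetric] divide_simps del: ennreal_le_iff)
           (intro ennreal_leI, simp add: field_simps)
      finally show "(\<integral>\<^sup>+x. G x * indicator (- A k) x * riesz_op \<beta> (h n) x \<partial>lebesgue)\<^sup>2
          \<le> ennreal ((e / 2)\<^sup>2)" .
    qed (use e in simp)
    finally show ?case
      using e by (simp add: add_mono ennreal_plus[symmetric] del: ennreal_plus)
  qed
qed

text \<open>
  On the ball the potential is at least a positive constant times the integral of \<open>h n\<close> over the ball,
  so that integral times the integral of \<open>G\<close> is dominated by the tested potential.
\<close>

lemma riesz_op_locally_null_of_test:
  fixes h :: "nat \<Rightarrow> 'a::euclidean_space \<Rightarrow> ennreal" and G :: "'a \<Rightarrow> ennreal"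
  assumes \<beta>: "0 < \<beta>" "\<beta> < real DIM('a)"
    and h [measurable]: "\<And>n. h n \<in> borel_measurable lebesgue"
    and G [measurable]: "G \<in> borel_measurable lebesgue"
    and r: "0 < r" and G0: "(\<integral>\<^sup>+x\<in>cball 0 r. G x \<partial>lebesgue) \<noteq> 0"
    and null: "(\<lambda>n. \<integral>\<^sup>+x\<in>cball 0 r. G x * riesz_op \<beta> (h n) x \<partial>lebesgue) \<longlonglongrightarrow> 0"
  shows "(\<lambda>n. \<integral>\<^sup>+y\<in>cball 0 r. h n y \<partial>lebesgue) \<longlonglongrightarrow> 0"
proof (rule ennreal_tendsto_0_mult_cancel[OF null])
  define \<kappa> where "\<kappa> = riesz_const DIM('a) \<beta> * (2 * r) powr (- (real DIM('a) - \<beta>))"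
  have "0 < \<kappa>" using riesz_const_pos[OF \<beta>] r by (simp add: \<kappa>_def)
  then show "ennreal \<kappa> * (\<integral>\<^sup>+x\<in>cball 0 r. G x \<partial>lebesgue) \<noteq> 0" using G0 by simp
  fix n
  have "ennreal \<kappa> * (\<integral>\<^sup>+x\<in>cball 0 r. G x \<partial>lebesgue) * (\<integral>\<^sup>+y\<in>cball 0 r. h n y \<partial>lebesgue)
      = (\<integral>\<^sup>+x. ennreal \<kappa> * (\<integral>\<^sup>+y\<in>cball 0 r. h n y \<partial>lebesgue) * (G x * indicator (cball 0 r) x) \<partial>lebesgue)"
    by (subst nn_integral_cmult) (auto simp: mult_ac)
  also have "\<dots> \<le> (\<integral>\<^sup>+x\<in>cball 0 r. G x * riesz_op \<beta> (h n) x \<partial>lebesgue)"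
  proof (intro nn_integral_mono)
    fix x :: 'a
    show "ennreal \<kappa> * (\<integral>\<^sup>+y\<in>cball 0 r. h n y \<partial>lebesgue) * (G x * indicator (cball 0 r) x)
        \<le> G x * riesz_op \<beta> (h n) x * indicator (cball 0 r) x"
      using riesz_op_lower[OF \<beta> h, of x r n] unfolding \<kappa>_def[symmetric]
      by (auto split: split_indicator simp: mult.commute intro!: mult_left_mono)
  qed
  finally show "ennreal \<kappa> * (\<integral>\<^sup>+x\<in>cball 0 r. G x \<partial>lebesgue) * (\<integral>\<^sup>+y\<in>cball 0 r. h n y \<partial>lebesgue)
      \<le> (\<integral>\<^sup>+x\<in>cball 0 r. G x * riesz_op \<beta> (h n) x \<partial>lebesgue)" .
qed

section \<open>Domination and convergence\<close>

text \<open>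
  Dominated convergence in which the dominating functions vary but their integrals converge to the
  integral of their limit. It follows from Fatou's lemma applied to \<open>G n - h n \<ge> 0\<close>.
\<close>

lemma nn_integral_null_convergent_dominators:
  fixes h G :: "nat \<Rightarrow> 'b \<Rightarrow> ennreal"
  assumes [measurable]: "\<And>n. h n \<in> borel_measurable M" "\<And>n. G n \<in> borel_measurable M"
    and le: "\<And>n. AE x in M. h n x \<le> G n x"
    and h0: "AE x in M. (\<lambda>n. h n x) \<longlonglongrightarrow> 0"
    and Gg: "AE x in M. (\<lambda>n. G n x) \<longlonglongrightarrow> g x"
    and conv: "(\<lambda>n. \<integral>\<^sup>+x. G n x \<partial>M) \<longlonglongrightarrow> (\<integral>\<^sup>+x. g x \<partial>M)"
    and fin: "(\<integral>\<^sup>+x. g x \<partial>M) < \<infinity>"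
  shows "(\<lambda>n. \<integral>\<^sup>+x. h n x \<partial>M) \<longlonglongrightarrow> 0"
proof (rule ennreal_tendsto_0I)
  fix e :: real assume e: "0 < e"
  obtain a where a: "(\<integral>\<^sup>+x. g x \<partial>M) = ennreal a" "0 \<le> a"
    using fin by (cases "\<integral>\<^sup>+x. g x \<partial>M") auto
  have split: "(\<integral>\<^sup>+x. G n x - h n x \<partial>M) + (\<integral>\<^sup>+x. h n x \<partial>M) = (\<integral>\<^sup>+x. G n x \<partial>M)" for n
  proof (subst nn_integral_add[symmetric])
    show "(\<integral>\<^sup>+x. G n x - h n x + h n x \<partial>M) = (\<integral>\<^sup>+x. G n x \<partial>M)"
      using le[of n] by (intro nn_integral_cong_AE) (auto elim!: eventually_mono simp: diff_add_cancel_ennreal)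
  qed measurable
  have "ennreal a = (\<integral>\<^sup>+x. liminf (\<lambda>n. G n x - h n x) \<partial>M)"
    unfolding a(1)[symmetric]
  proof (intro nn_integral_cong_AE)
    show "AE x in M. g x = liminf (\<lambda>n. G n x - h n x)"
      using h0 Gg
    proof eventually_elim
      case (elim x)
      have "(\<lambda>n. G n x - h n x) \<longlonglongrightarrow> g x - 0"
        using elim by (intro tendsto_diff_ennreal_general) auto
      then show ?case by (simp add: lim_imp_Liminf)
    qed
  qed
  also have "\<dots> \<le> liminf (\<lambda>n. \<integral>\<^sup>+x. G n x - h n x \<partial>M)"
    by (intro nn_integral_liminf) measurable
  finally have lim: "ennreal a \<le> liminf (\<lambda>n. \<integral>\<^sup>+x. G n x - h n x \<partial>M)" .
  have low: "eventually (\<lambda>n. ennreal (a - e / 2) \<le> (\<integral>\<^sup>+x. G n x - h n x \<partial>M)) sequentially"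
  proof (cases "a \<le> e / 2")
    case True
    then show ?thesis by (simp add: ennreal_neg)
  next
    case False
    then have "ennreal (a - e / 2) < ennreal a" using e by (simp add: ennreal_less_iff)
    then have "ennreal (a - e / 2) < liminf (\<lambda>n. \<integral>\<^sup>+x. G n x - h n x \<partial>M)"
      using lim by (rule order.strict_trans2)
    then show ?thesis by (rule eventually_mono[OF less_LiminfD]) simp
  qed
  have "(\<integral>\<^sup>+x. g x \<partial>M) < ennreal (a + e / 2)"
    unfolding a(1) using a(2) e by (simp add: ennreal_less_iff)
  from order_tendstoD(2)[OF conv this] low
  show "eventually (\<lambda>n. (\<integral>\<^sup>+x. h n x \<partial>M) \<le> ennreal e) sequentially"
  proof eventually_elim
    case (elim n)
    define A where "A = (\<integral>\<^sup>+x. G n x - h n x \<partial>M)"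
    define H where "H = (\<integral>\<^sup>+x. h n x \<partial>M)"
    have AH: "A + H < ennreal (a + e / 2)" using elim(1) split[of n] by (simp add: A_def H_def)
    then have "A < \<infinity>" "H < \<infinity>" using order.strict_trans[OF AH ennreal_less_top] by auto
    then obtain b c where bc: "A = ennreal b" "0 \<le> b" "H = ennreal c" "0 \<le> c"
      by (cases A; cases H) auto
    have "b + c < a + e / 2"
      using AH bc by (simp add: ennreal_plus[symmetric] ennreal_less_iff del: ennreal_plus)
    moreover have "a - e / 2 \<le> b" using elim(2) bc unfolding A_def[symmetric] by simp
    ultimately have "c \<le> e" by simp
    then show ?case using bc(3) unfolding H_def by (simp add: ennreal_leI)
  qed
qed

lemma continuous_on_power2_ennreal: "continuous_on UNIV (\<lambda>x::ennreal. x\<^sup>2)"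
  unfolding continuous_on_def power2_eq_square by (auto intro!: tendsto_mult_ennreal)

lemma liminf_power2_ennreal:
  fixes a :: "nat \<Rightarrow> ennreal"
  shows "liminf (\<lambda>n. (a n)\<^sup>2) = (liminf a)\<^sup>2"
  by (rule Liminf_compose_continuous_mono[OF continuous_on_power2_ennreal])
     (auto simp: mono_def power_mono_ennreal)

lemma power2_sum_le_ennreal:
  fixes a b :: ennreal
  shows "(a + b)\<^sup>2 \<le> 2 * a\<^sup>2 + 2 * b\<^sup>2"
proof -
  have "(a + b)\<^sup>2 = (a\<^sup>2 + b\<^sup>2) + 2 * a * b"
    by (rule power2_sum)
  also have "\<dots> \<le> (a\<^sup>2 + b\<^sup>2) + (a\<^sup>2 + b\<^sup>2)"
    by (intro add_mono order.refl sum_of_squares_ge_ennreal)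
  finally show ?thesis by (simp add: mult_2 add_ac)
qed

text \<open>
  Fatou's lemma is used twice, for the potentials at a fixed point and then for the integral of
  their squares.
\<close>

lemma riesz_op_L2_Fatou:
  fixes h :: "nat \<Rightarrow> 'a::euclidean_space \<Rightarrow> ennreal"
  assumes h [measurable]: "\<And>n. h n \<in> borel_measurable lebesgue"
    and lim: "AE x in lebesgue. (\<lambda>n. h n x) \<longlonglongrightarrow> f x"
    and C: "\<And>n. (\<integral>\<^sup>+x. (riesz_op \<beta> (h n) x)\<^sup>2 \<partial>lebesgue) \<le> C"
  shows "(\<integral>\<^sup>+x. (riesz_op \<beta> f x)\<^sup>2 \<partial>lebesgue) \<le> C"
proof -
  have "riesz_op \<beta> f x \<le> liminf (\<lambda>n. riesz_op \<beta> (h n) x)" for x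
  proof -
    have "riesz_op \<beta> f x = (\<integral>\<^sup>+y. liminf (\<lambda>n. ennreal (riesz_kernel \<beta> (x - y)) * h n y) \<partial>lebesgue)"
      unfolding riesz_op_def
    proof (intro nn_integral_cong_AE)
      show "AE y in lebesgue. ennreal (riesz_kernel \<beta> (x - y)) * f y
          = liminf (\<lambda>n. ennreal (riesz_kernel \<beta> (x - y)) * h n y)"
        using lim
      proof eventually_elim
        case (elim y)
        then show ?case by (intro lim_imp_Liminf[symmetric] ennreal_tendsto_cmult) auto
      qed
    qed
    also have "\<dots> \<le> liminf (\<lambda>n. riesz_op \<beta> (h n) x)"
      unfolding riesz_op_def by (intro nn_integral_liminf) measurable
    finally show ?thesis .
  qed
  then have "(\<integral>\<^sup>+x. (riesz_op \<beta> f x)\<^sup>2 \<partial>lebesgue)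
      \<le> (\<integral>\<^sup>+x. liminf (\<lambda>n. (riesz_op \<beta> (h n) x)\<^sup>2) \<partial>lebesgue)"
    by (intro nn_integral_mono) (simp add: liminf_power2_ennreal power_mono_ennreal)
  also have "\<dots> \<le> liminf (\<lambda>n. \<integral>\<^sup>+x. (riesz_op \<beta> (h n) x)\<^sup>2 \<partial>lebesgue)"
    by (intro nn_integral_liminf) measurable
  also have "\<dots> \<le> C"
    using C by (intro Liminf_le) auto
  finally show ?thesis .
qed

lemma AE_finite_of_L2:
  fixes F :: "'a \<Rightarrow> ennreal"
  assumes [measurable]: "F \<in> borel_measurable M" and "(\<integral>\<^sup>+x. (F x)\<^sup>2 \<partial>M) < \<infinity>"
  shows "AE x in M. F x < \<infinity>"
proof -
  have "AE x in M. (F x)\<^sup>2 \<noteq> \<infinity>" using assms by (intro nn_integral_noteq_infinite) auto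
  then show ?thesis by eventually_elim (auto simp: less_top[symmetric])
qed

lemma riesz_op_dominated_L2_null:
  fixes w :: "nat \<Rightarrow> 'a::euclidean_space \<Rightarrow> ennreal"
  assumes w [measurable]: "\<And>n. w n \<in> borel_measurable lebesgue"
    and F [measurable]: "F \<in> borel_measurable lebesgue"
    and dom: "\<And>n. AE x in lebesgue. w n x \<le> F x"
    and null: "AE x in lebesgue. (\<lambda>n. w n x) \<longlonglongrightarrow> 0"
    and fin: "(\<integral>\<^sup>+x. (riesz_op \<beta> F x)\<^sup>2 \<partial>lebesgue) < \<infinity>"
  shows "(\<lambda>n. \<integral>\<^sup>+x. (riesz_op \<beta> (w n) x)\<^sup>2 \<partial>lebesgue) \<longlonglongrightarrow> 0"
proof -
  have "(\<lambda>n. \<integral>\<^sup>+x. (riesz_op \<beta> (w n) x)\<^sup>2 \<partial>lebesgue) \<longlonglongrightarrow> (\<integral>\<^sup>+x. 0 \<partial>(lebesgue :: 'a measure))"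
  proof (rule nn_integral_dominated_convergence[where w = "\<lambda>x. (riesz_op \<beta> F x)\<^sup>2"])
    show "AE x in lebesgue. (riesz_op \<beta> (w n) x)\<^sup>2 \<le> (riesz_op \<beta> F x)\<^sup>2" for n
      by (intro AE_I2 power_mono_ennreal riesz_op_mono_AE dom)
    have "AE x in lebesgue. riesz_op \<beta> F x < \<infinity>"
      by (rule AE_finite_of_L2[OF _ fin]) measurable
    then show "AE x in lebesgue. (\<lambda>n. (riesz_op \<beta> (w n) x)\<^sup>2) \<longlonglongrightarrow> 0"
    proof eventually_elim
      case (elim x)
      have "(\<lambda>n. riesz_op \<beta> (w n) x) \<longlonglongrightarrow> (\<integral>\<^sup>+y. 0 \<partial>(lebesgue :: 'a measure))"
        unfolding riesz_op_def
      proof (rule nn_integral_dominated_convergence[where w = "\<lambda>y. ennreal (riesz_kernel \<beta> (x - y)) * F y"])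
        show "AE y in lebesgue. ennreal (riesz_kernel \<beta> (x - y)) * w n y
            \<le> ennreal (riesz_kernel \<beta> (x - y)) * F y" for n
          using dom[of n] by (auto elim!: eventually_mono intro: mult_left_mono)
        show "AE y in lebesgue. (\<lambda>n. ennreal (riesz_kernel \<beta> (x - y)) * w n y) \<longlonglongrightarrow> 0"
          using null by (auto elim!: eventually_mono intro: ennreal_tendsto_0_cmult)
      qed (use elim in \<open>auto simp: riesz_op_def\<close>)
      then have "(\<lambda>n. riesz_op \<beta> (w n) x) \<longlonglongrightarrow> 0" by simp
      then have "(\<lambda>n. riesz_op \<beta> (w n) x * riesz_op \<beta> (w n) x) \<longlonglongrightarrow> 0 * 0"
        by (intro tendsto_mult_ennreal) auto
      then show ?case by (simp add: power2_eq_square)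
    qed
  qed (use fin in auto)
  then show ?thesis by simp
qed

section \<open>The inequality of Brezis and Lieb\<close>

lemma powr_abs_add_le:
  fixes a b p :: real
  assumes "0 \<le> p"
  shows "\<bar>a + b\<bar> powr p \<le> 2 powr p * (\<bar>a\<bar> powr p + \<bar>b\<bar> powr p)"
proof -
  have "\<bar>a + b\<bar> powr p \<le> (2 * max \<bar>a\<bar> \<bar>b\<bar>) powr p"
    using assms by (intro powr_mono2) auto
  also have "\<dots> = 2 powr p * max \<bar>a\<bar> \<bar>b\<bar> powr p"
    by (simp add: powr_mult)
  also have "max \<bar>a\<bar> \<bar>b\<bar> powr p \<le> \<bar>a\<bar> powr p + \<bar>b\<bar> powr p"
    by (simp add: max_def)
  finally show ?thesis by simp
qed

text \<open>
  By homogeneity the inequality only concerns the ratio \<open>t = b / a\<close>. If \<open>|t| < \<delta>\<close>, continuity of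
  \<open>|1 + t|\<^sup>p\<close> at \<open>0\<close> gives the small factor \<open>\<epsilon>\<close>. Otherwise \<open>|a| \<le> |b| / \<delta>\<close> and every term is bounded by
  a multiple of \<open>|b|\<^sup>p\<close>.
\<close>

lemma brezis_lieb_inequality:
  fixes p \<epsilon> :: real
  assumes p: "0 < p" and \<epsilon>: "0 < \<epsilon>"
  obtains C where "0 \<le> C" "\<And>a b :: real. \<bar>\<bar>a + b\<bar> powr p - \<bar>a\<bar> powr p - \<bar>b\<bar> powr p\<bar>
      \<le> \<epsilon> * \<bar>a\<bar> powr p + C * \<bar>b\<bar> powr p"
proof -
  have "((\<lambda>t::real. \<bar>1 + t\<bar> powr p) \<longlongrightarrow> \<bar>1 + 0\<bar> powr p) (at 0)"
    by (intro tendsto_intros) auto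
  then obtain \<delta> where \<delta>: "0 < \<delta>" "\<And>t. t \<noteq> 0 \<Longrightarrow> \<bar>t\<bar> < \<delta> \<Longrightarrow> \<bar>\<bar>1 + t\<bar> powr p - 1\<bar> < \<epsilon>"
    using \<epsilon> unfolding LIM_def by (auto simp: dist_real_def)
  define C where "C = (1 + 1 / \<delta>) powr p + 1"
  have near_case: "\<bar>X - Y - Z\<bar> \<le> E + E'" if "\<bar>X - Y\<bar> \<le> E" "0 \<le> Z" "Z \<le> E'" for X Y Z E E' :: real
    using that by linarith
  have far_case: "\<bar>X - Y - Z\<bar> \<le> E + E'"
    if "X \<le> B" "Y \<le> B" "E' = B + Z" "0 \<le> E" "0 \<le> X" "0 \<le> Y" "0 \<le> Z" for X Y Z B E E' :: real
    using that by linarith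
  have "\<bar>\<bar>a + b\<bar> powr p - \<bar>a\<bar> powr p - \<bar>b\<bar> powr p\<bar> \<le> \<epsilon> * \<bar>a\<bar> powr p + C * \<bar>b\<bar> powr p" for a b :: real
  proof (cases "\<bar>b\<bar> < \<delta> * \<bar>a\<bar>")
    case True
    then have a: "a \<noteq> 0" using \<delta>(1) by auto
    have near: "\<bar>\<bar>1 + b / a\<bar> powr p - 1\<bar> \<le> \<epsilon>"
      using \<delta>(2)[of "b / a"] True a \<epsilon> by (cases "b = 0") (auto simp: divide_simps)
    have "\<bar>a + b\<bar> powr p = \<bar>1 + b / a\<bar> powr p * \<bar>a\<bar> powr p"
    proof -
      have "a + b = (1 + b / a) * a" using a by (simp add: field_simps)
      then have "\<bar>a + b\<bar> = \<bar>1 + b / a\<bar> * \<bar>a\<bar>" by (simp only: abs_mult)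
      then show ?thesis by (simp only: powr_mult)
    qed
    then have diff: "\<bar>a + b\<bar> powr p - \<bar>a\<bar> powr p = (\<bar>1 + b / a\<bar> powr p - 1) * \<bar>a\<bar> powr p"
      by (simp only: left_diff_distrib mult_1)
    have "\<bar>\<bar>a + b\<bar> powr p - \<bar>a\<bar> powr p\<bar> \<le> \<epsilon> * \<bar>a\<bar> powr p"
      unfolding diff abs_mult abs_of_nonneg[OF powr_ge_zero]
      by (rule mult_right_mono[OF near powr_ge_zero])
    moreover have "\<bar>b\<bar> powr p \<le> C * \<bar>b\<bar> powr p"
      unfolding C_def distrib_right mult_1 by simp
    ultimately show ?thesis by (rule near_case[OF _ powr_ge_zero])
  next
    case False
    then have a: "\<bar>a\<bar> \<le> \<bar>b\<bar> / \<delta>" using \<delta>(1) by (simp add: field_simps)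
    have "\<bar>a + b\<bar> powr p \<le> ((1 + 1 / \<delta>) * \<bar>b\<bar>) powr p"
      using a p by (intro powr_mono2) (auto simp: field_simps)
    moreover have "\<bar>a\<bar> powr p \<le> ((1 + 1 / \<delta>) * \<bar>b\<bar>) powr p"
      using a p by (intro powr_mono2) (auto simp: field_simps)
    ultimately have "\<bar>a + b\<bar> powr p \<le> (1 + 1 / \<delta>) powr p * \<bar>b\<bar> powr p"
        "\<bar>a\<bar> powr p \<le> (1 + 1 / \<delta>) powr p * \<bar>b\<bar> powr p"
      using \<delta>(1) by (simp_all add: powr_mult)
    moreover have "C * \<bar>b\<bar> powr p = (1 + 1 / \<delta>) powr p * \<bar>b\<bar> powr p + \<bar>b\<bar> powr p"
      by (simp only: C_def distrib_right mult_1)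
    moreover have "0 \<le> \<epsilon> * \<bar>a\<bar> powr p" using \<epsilon> by simp
    ultimately show ?thesis
      by (intro far_case powr_ge_zero)
  qed
  then show ?thesis by (intro that[of C]) (simp_all add: C_def)
qed

text \<open>
  The part of the remainder that exceeds \<open>\<epsilon> |v n|\<^sup>p\<close> is dominated by a multiple of \<open>|u|\<^sup>p\<close> and tends to zero almost
  everywhere, so its potential tends to zero in \<open>L\<^sup>2\<close>. The other part contributes at most \<open>\<epsilon>\<close> times
  the uniformly bounded potential of \<open>|v n|\<^sup>p\<close>.
\<close>

lemma riesz_op_brezis_lieb_remainder:
  fixes v :: "nat \<Rightarrow> 'a::euclidean_space \<Rightarrow> real" and u :: "'a \<Rightarrow> real"
  assumes p: "0 < p"
    and v [measurable]: "\<And>n. v n \<in> borel_measurable lebesgue"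
    and u [measurable]: "u \<in> borel_measurable lebesgue"
    and lim: "AE x in lebesgue. (\<lambda>n. v n x) \<longlonglongrightarrow> 0"
    and C: "0 \<le> C" "\<And>n. (\<integral>\<^sup>+x. (riesz_op \<beta> (\<lambda>y. ennreal (\<bar>v n y\<bar> powr p)) x)\<^sup>2 \<partial>lebesgue) \<le> ennreal C"
    and fin: "(\<integral>\<^sup>+x. (riesz_op \<beta> (\<lambda>y. ennreal (\<bar>u y\<bar> powr p)) x)\<^sup>2 \<partial>lebesgue) < \<infinity>"
  shows "(\<lambda>n. \<integral>\<^sup>+x. (riesz_op \<beta> (\<lambda>y. ennreal \<bar>\<bar>v n y + u y\<bar> powr p - \<bar>v n y\<bar> powr p - \<bar>u y\<bar> powr p\<bar>) x)\<^sup>2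
      \<partial>lebesgue) \<longlonglongrightarrow> 0"
proof (rule ennreal_tendsto_0I)
  fix e :: real assume e: "0 < e"
  \<comment> \<open>Chosen so that \<open>2 \<epsilon>\<^sup>2 C \<le> e / 2\<close>; the \<open>1\<close> covers \<open>C = 0\<close>.\<close>
  define \<epsilon> where "\<epsilon> = sqrt (e / (4 * (C + 1)))"
  have \<epsilon>: "0 < \<epsilon>" using e C(1) by (simp add: \<epsilon>_def)
  have \<epsilon>C: "2 * \<epsilon>\<^sup>2 * C \<le> e / 2"
    using e C(1) by (simp add: \<epsilon>_def field_simps)
  obtain D where D: "0 \<le> D" "\<And>a b :: real. \<bar>\<bar>a + b\<bar> powr p - \<bar>a\<bar> powr p - \<bar>b\<bar> powr p\<bar>
      \<le> \<epsilon> * \<bar>a\<bar> powr p + D * \<bar>b\<bar> powr p"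
    using brezis_lieb_inequality[OF p \<epsilon>] by blast
  define r where "r n y = \<bar>\<bar>v n y + u y\<bar> powr p - \<bar>v n y\<bar> powr p - \<bar>u y\<bar> powr p\<bar>" for n y
  \<comment> \<open>The coercion to \<open>[0, \<infinity>]\<close> truncates negative values, so this is the positive part.\<close>
  define w where "w n y = ennreal (r n y - \<epsilon> * \<bar>v n y\<bar> powr p)" for n y
  have r [measurable]: "r n \<in> borel_measurable lebesgue" for n
    unfolding r_def[abs_def] by measurable
  have w [measurable]: "w n \<in> borel_measurable lebesgue" for n
    unfolding w_def[abs_def] by measurable
  have "(\<lambda>n. \<integral>\<^sup>+x. (riesz_op \<beta> (w n) x)\<^sup>2 \<partial>lebesgue) \<longlonglongrightarrow> 0"
  proof (rule riesz_op_dominated_L2_null[where F = "\<lambda>y. ennreal D * ennreal (\<bar>u y\<bar> powr p)"])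
    show "AE x in lebesgue. w n x \<le> ennreal D * ennreal (\<bar>u x\<bar> powr p)" for n
    proof (intro AE_I2)
      fix x
      have "r n x - \<epsilon> * \<bar>v n x\<bar> powr p \<le> D * \<bar>u x\<bar> powr p"
        unfolding r_def diff_le_eq by (subst add.commute) (rule D(2))
      then show "w n x \<le> ennreal D * ennreal (\<bar>u x\<bar> powr p)"
        unfolding w_def using D(1) by (simp add: ennreal_mult[symmetric] ennreal_leI)
    qed
    show "AE x in lebesgue. (\<lambda>n. w n x) \<longlonglongrightarrow> 0"
      using lim
    proof eventually_elim
      case (elim x)
      have "(\<lambda>n. r n x - \<epsilon> * \<bar>v n x\<bar> powr p) \<longlonglongrightarrow>
          \<bar>\<bar>0 + u x\<bar> powr p - \<bar>0\<bar> powr p - \<bar>u x\<bar> powr p\<bar> - \<epsilon> * \<bar>0\<bar> powr p"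
        unfolding r_def using elim p by (intro tendsto_intros) auto
      then show ?case unfolding w_def using p by (simp add: tendsto_ennrealI flip: ennreal_0)
    qed
    have "(\<integral>\<^sup>+x. (riesz_op \<beta> (\<lambda>y. ennreal D * ennreal (\<bar>u y\<bar> powr p)) x)\<^sup>2 \<partial>lebesgue)
        = (ennreal D)\<^sup>2 * (\<integral>\<^sup>+x. (riesz_op \<beta> (\<lambda>y. ennreal (\<bar>u y\<bar> powr p)) x)\<^sup>2 \<partial>lebesgue)"
      by (subst riesz_op_cmult) (auto simp: power_mult_distrib nn_integral_cmult)
    then show "(\<integral>\<^sup>+x. (riesz_op \<beta> (\<lambda>y. ennreal D * ennreal (\<bar>u y\<bar> powr p)) x)\<^sup>2 \<partial>lebesgue) < \<infinity>"
      using fin D(1) by (simp add: ennreal_mult_less_top ennreal_power)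
  qed measurable
  from ennreal_tendsto_0D[OF this, of "e / 4"] e
  have "eventually (\<lambda>n. (\<integral>\<^sup>+x. (riesz_op \<beta> (w n) x)\<^sup>2 \<partial>lebesgue) \<le> ennreal (e / 4)) sequentially"
    by simp
  then show "eventually (\<lambda>n. (\<integral>\<^sup>+x. (riesz_op \<beta> (\<lambda>y. ennreal \<bar>\<bar>v n y + u y\<bar> powr p
      - \<bar>v n y\<bar> powr p - \<bar>u y\<bar> powr p\<bar>) x)\<^sup>2 \<partial>lebesgue) \<le> ennreal e) sequentially"
  proof eventually_elim
    case (elim n)
    let ?g = "\<lambda>y. ennreal (\<bar>v n y\<bar> powr p)"
    have "riesz_op \<beta> (\<lambda>y. ennreal (r n y)) x \<le> ennreal \<epsilon> * riesz_op \<beta> ?g x + riesz_op \<beta> (w n) x" for x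
    proof -
      have "riesz_op \<beta> (\<lambda>y. ennreal (r n y)) x \<le> riesz_op \<beta> (\<lambda>y. ennreal \<epsilon> * ?g y + w n y) x"
      proof (intro riesz_op_mono_AE AE_I2)
        fix y
        have "ennreal (r n y) \<le> ennreal (\<epsilon> * \<bar>v n y\<bar> powr p + max 0 (r n y - \<epsilon> * \<bar>v n y\<bar> powr p))"
          by (intro ennreal_leI) simp
        also have "\<dots> = ennreal \<epsilon> * ?g y + w n y"
          unfolding w_def using \<epsilon> by (subst ennreal_plus) (auto simp: ennreal_mult max_def ennreal_neg)
        finally show "ennreal (r n y) \<le> ennreal \<epsilon> * ?g y + w n y" .
      qed
      then show ?thesis by (simp add: riesz_op_add riesz_op_cmult)
    qed
    then have "(riesz_op \<beta> (\<lambda>y. ennreal (r n y)) x)\<^sup>2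
        \<le> 2 * (ennreal \<epsilon> * riesz_op \<beta> ?g x)\<^sup>2 + 2 * (riesz_op \<beta> (w n) x)\<^sup>2" for x
      by (rule order.trans[OF power_mono_ennreal power2_sum_le_ennreal])
    then have "(\<integral>\<^sup>+x. (riesz_op \<beta> (\<lambda>y. ennreal (r n y)) x)\<^sup>2 \<partial>lebesgue)
        \<le> (\<integral>\<^sup>+x. 2 * (ennreal \<epsilon> * riesz_op \<beta> ?g x)\<^sup>2 + 2 * (riesz_op \<beta> (w n) x)\<^sup>2 \<partial>lebesgue)"
      by (intro nn_integral_mono)
    also have "\<dots> = 2 * (ennreal \<epsilon>)\<^sup>2 * (\<integral>\<^sup>+x. (riesz_op \<beta> ?g x)\<^sup>2 \<partial>lebesgue)
        + 2 * (\<integral>\<^sup>+x. (riesz_op \<beta> (w n) x)\<^sup>2 \<partial>lebesgue)"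
      by (simp add: nn_integral_add nn_integral_cmult power_mult_distrib mult.assoc)
    also have "\<dots> \<le> 2 * (ennreal \<epsilon>)\<^sup>2 * ennreal C + 2 * ennreal (e / 4)"
      by (intro add_mono mult_left_mono C elim) auto
    also have "\<dots> = ennreal (2 * \<epsilon>\<^sup>2 * C + e / 2)"
    proof -
      have "2 * (ennreal \<epsilon>)\<^sup>2 * ennreal C = ennreal (2 * \<epsilon>\<^sup>2 * C)"
        using \<epsilon> C(1) by (simp add: ennreal_mult ennreal_power)
      moreover have "2 * ennreal (e / 4) = ennreal (e / 2)"
        using e ennreal_mult[of 2 "e / 4"] by simp
      ultimately show ?thesis using \<epsilon> C(1) e by (simp add: ennreal_plus)
    qed
    also have "\<dots> \<le> ennreal e" using \<epsilon>C by (intro ennreal_leI) simp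
    finally show ?case unfolding r_def .
  qed
qed

section \<open>Square-integrable potentials\<close>

lemma nn_integral_mult_null:
  fixes a b :: "nat \<Rightarrow> 'b \<Rightarrow> ennreal"
  assumes [measurable]: "\<And>n. a n \<in> borel_measurable M" "\<And>n. b n \<in> borel_measurable M"
    and a: "(\<lambda>n. \<integral>\<^sup>+x. (a n x)\<^sup>2 \<partial>M) \<longlonglongrightarrow> 0"
    and b: "0 \<le> B" "\<And>n. (\<integral>\<^sup>+x. (b n x)\<^sup>2 \<partial>M) \<le> ennreal B"
  shows "(\<lambda>n. \<integral>\<^sup>+x. a n x * b n x \<partial>M) \<longlonglongrightarrow> 0"
proof (rule ennreal_tendsto_0I)
  fix e :: real assume e: "0 < e"
  have "0 < e\<^sup>2 / (B + 1)" using e b(1) by simp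
  from ennreal_tendsto_0D[OF a this]
  show "eventually (\<lambda>n. (\<integral>\<^sup>+x. a n x * b n x \<partial>M) \<le> ennreal e) sequentially"
  proof eventually_elim
    case (elim n)
    have "(\<integral>\<^sup>+x. a n x * b n x \<partial>M)\<^sup>2 \<le> (\<integral>\<^sup>+x. (a n x)\<^sup>2 \<partial>M) * (\<integral>\<^sup>+x. (b n x)\<^sup>2 \<partial>M)"
      by (rule Cauchy_Schwarz_nn_integral) measurable
    also have "\<dots> \<le> ennreal (e\<^sup>2 / (B + 1)) * ennreal B"
      by (intro mult_mono elim b) auto
    also have "\<dots> = ennreal (e\<^sup>2 / (B + 1) * B)" using b(1) by (subst ennreal_mult) auto
    also have "\<dots> \<le> ennreal (e\<^sup>2)"
      using b(1) by (intro ennreal_leI) (simp add: field_simps)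
    finally show ?case by (rule ennreal_power2_le_imp_le) (use e in simp)
  qed
qed

lemma integrable_mult_L2:
  fixes f g :: "'a::euclidean_space \<Rightarrow> real"
  assumes "f \<in> L2" "g \<in> L2"
  shows "integrable lebesgue (\<lambda>x. f x * g x)"
proof (rule Bochner_Integration.integrable_bound)
  show "integrable lebesgue (\<lambda>x. (f x)\<^sup>2 + (g x)\<^sup>2)"
    using assms by (simp add: L2_def)
  show "(\<lambda>x. f x * g x) \<in> borel_measurable lebesgue"
    using assms by (intro borel_measurable_times) (auto simp: L2_def)
  have "\<bar>a * b\<bar> \<le> a\<^sup>2 + b\<^sup>2" for a b :: real
  proof -
    have "2 * \<bar>a\<bar> * \<bar>b\<bar> \<le> \<bar>a\<bar>\<^sup>2 + \<bar>b\<bar>\<^sup>2" by (rule sum_squares_bound)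
    moreover have "0 \<le> \<bar>a\<bar> * \<bar>b\<bar>" by (intro mult_nonneg_nonneg abs_ge_zero)
    moreover have "z \<le> s" if "2 * z \<le> s" "0 \<le> z" for z s :: real
      using that by simp
    ultimately show ?thesis unfolding abs_mult power2_abs mult.assoc by blast
  qed
  then show "AE x in lebesgue. norm (f x * g x) \<le> norm ((f x)\<^sup>2 + (g x)\<^sup>2)"
    by (auto simp: abs_of_nonneg)
qed

lemma enn2real_L2:
  fixes F :: "'a::euclidean_space \<Rightarrow> ennreal"
  assumes [measurable]: "F \<in> borel_measurable lebesgue" and fin: "(\<integral>\<^sup>+x. (F x)\<^sup>2 \<partial>lebesgue) < \<infinity>"
  shows "(\<lambda>x. enn2real (F x)) \<in> L2" and "AE x in lebesgue. ennreal (enn2real (F x)) = F x"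
proof -
  show ae: "AE x in lebesgue. ennreal (enn2real (F x)) = F x"
    using AE_finite_of_L2[OF assms] by eventually_elim simp
  have "(\<integral>\<^sup>+x. ennreal ((enn2real (F x))\<^sup>2) \<partial>lebesgue) = (\<integral>\<^sup>+x. (F x)\<^sup>2 \<partial>lebesgue)"
    using ae by (intro nn_integral_cong_AE) (auto elim!: eventually_mono simp: ennreal_power[symmetric])
  with fin show "(\<lambda>x. enn2real (F x)) \<in> L2"
    by (auto simp: L2_def intro!: integrableI_nonneg)
qed

lemma not_AE_notin_cball:
  assumes "0 < r"
  shows "\<not> (AE x in lebesgue. x \<notin> cball (0::'a::euclidean_space) r)"
proof
  assume "AE x in lebesgue. x \<notin> cball (0::'a) r"
  then have "emeasure lebesgue (cball (0::'a) r) = 0" by (subst (asm) AE_iff_measurable[of "cball 0 r"]) auto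
  with assms show False using emeasure_cball[of r "0::'a"] unit_ball_vol_pos[of "real DIM('a)"] by simp
qed

lemma riesz_op_locally_finite:
  fixes h :: "'a::euclidean_space \<Rightarrow> ennreal"
  assumes \<beta>: "0 < \<beta>" "\<beta> < real DIM('a)" and h [measurable]: "h \<in> borel_measurable lebesgue"
    and fin: "(\<integral>\<^sup>+x. (riesz_op \<beta> h x)\<^sup>2 \<partial>lebesgue) < \<infinity>" and r: "0 < r"
  shows "(\<integral>\<^sup>+y\<in>cball 0 r. h y \<partial>lebesgue) < \<infinity>"
proof -
  have ae: "AE x in lebesgue. riesz_op \<beta> h x < \<infinity>"
    by (rule AE_finite_of_L2[OF _ fin]) measurable
  have "\<exists>x\<in>cball 0 r. riesz_op \<beta> h x < \<infinity>"
  proof (rule ccontr)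
    assume "\<not> ?thesis"
    with ae have "AE x in lebesgue. x \<notin> cball (0::'a) r" by (auto elim!: eventually_mono)
    with not_AE_notin_cball[OF r] show False by blast
  qed
  then obtain x where x: "norm x \<le> r" "riesz_op \<beta> h x < \<infinity>" by auto
  show ?thesis
    using order.strict_trans1[OF riesz_op_lower[OF \<beta> h x(1)] x(2)] riesz_const_pos[OF \<beta>] r
    by (auto simp: ennreal_mult_less_top)
qed

text \<open>
  If the potential vanished at one point, the strictly positive kernel would force \<open>h\<close> to vanish
  almost everywhere.
\<close>

lemma riesz_op_pos:
  fixes h :: "'a::euclidean_space \<Rightarrow> ennreal"
  assumes \<beta>: "0 < \<beta>" "\<beta> < real DIM('a)" and h [measurable]: "h \<in> borel_measurable lebesgue"
    and nz: "\<not> (AE y in lebesgue. h y = 0)"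
  shows "0 < riesz_op \<beta> h x"
proof (rule ccontr)
  assume "\<not> 0 < riesz_op \<beta> h x"
  then have "AE y in lebesgue. ennreal (riesz_kernel \<beta> (x - y)) * h y = 0"
    unfolding riesz_op_def by (subst (asm) not_gr_zero, subst (asm) nn_integral_0_iff_AE) auto
  moreover have "AE y in lebesgue. y \<noteq> x"
    by (intro AE_completion AE_lborel_singleton)
  ultimately have "AE y in lebesgue. h y = 0"
  proof eventually_elim
    case (elim y)
    then have "0 < riesz_kernel \<beta> (x - y)"
      using riesz_const_pos[OF \<beta>] by (simp add: riesz_kernel_def)
    with elim show ?case by simp
  qed
  with nz show False by simp
qed

section \<open>Bounded sequences that converge almost everywhere\<close>

lemma abs_diff_bounds:
  fixes a b :: real
  assumes "0 \<le> a" "0 \<le> b"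
  shows "\<bar>a - b\<bar> \<le> a + b" "a \<le> \<bar>a - b\<bar> + b" "b \<le> \<bar>a - b\<bar> + a"
  using assms by auto

locale riesz_bounded_sequence =
  fixes U :: "nat \<Rightarrow> 'a::euclidean_space \<Rightarrow> real" and u :: "'a \<Rightarrow> real" and \<beta> p C :: real
  assumes order: "0 < \<beta>" "\<beta> < real DIM('a)"
    and p: "1 \<le> p"
    and U [measurable]: "\<And>n. U n \<in> borel_measurable lebesgue"
    and lim: "AE x in lebesgue. (\<lambda>n. U n x) \<longlonglongrightarrow> u x"
    and C: "0 \<le> C" "\<And>n. (\<integral>\<^sup>+x. (riesz_op \<beta> (\<lambda>y. ennreal (\<bar>U n y\<bar> powr p)) x)\<^sup>2 \<partial>lebesgue) \<le> ennreal C"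
begin

lemma borel_measurable_limit [measurable]: "u \<in> borel_measurable lebesgue"
proof (rule borel_measurable_AE)
  show "(\<lambda>x. lim (\<lambda>n. U n x)) \<in> borel_measurable lebesgue" by measurable
  show "AE x in lebesgue. lim (\<lambda>n. U n x) = u x"
    using lim by eventually_elim (rule limI)
qed

abbreviation f :: "nat \<Rightarrow> 'a \<Rightarrow> ennreal" where "f n y \<equiv> ennreal (\<bar>U n y\<bar> powr p)"
abbreviation f\<^sub>0 :: "'a \<Rightarrow> ennreal" where "f\<^sub>0 y \<equiv> ennreal (\<bar>u y\<bar> powr p)"
abbreviation g :: "nat \<Rightarrow> 'a \<Rightarrow> ennreal" where "g n y \<equiv> ennreal (\<bar>U n y - u y\<bar> powr p)"
abbreviation d :: "nat \<Rightarrow> 'a \<Rightarrow> ennreal" where "d n y \<equiv> ennreal \<bar>\<bar>U n y\<bar> powr p - \<bar>u y\<bar> powr p\<bar>"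

lemma f_lim: "AE x in lebesgue. (\<lambda>n. f n x) \<longlonglongrightarrow> f\<^sub>0 x"
  using lim
proof eventually_elim
  case (elim x)
  then show ?case using p by (intro tendsto_ennrealI tendsto_powr' tendsto_intros) auto
qed

lemma riesz_op_f0_bound: "(\<integral>\<^sup>+x. (riesz_op \<beta> f\<^sub>0 x)\<^sup>2 \<partial>lebesgue) \<le> ennreal C"
  by (rule riesz_op_L2_Fatou[OF _ f_lim C(2)]) measurable

text \<open>
  The constant in the \<open>L\<^sup>2\<close> bound of the potential of a function below \<open>c (f n + f\<^sub>0)\<close>; the factor \<open>4\<close> comes from
  \<open>(a + b)\<^sup>2 \<le> 2 a\<^sup>2 + 2 b\<^sup>2\<close> where the integrals of both squares are at most \<open>C\<close>.
\<close>

definition bound :: "real \<Rightarrow> real" where "bound c = c\<^sup>2 * (4 * C)"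

lemma bound_nonneg: "0 \<le> bound c"
  using C(1) by (simp add: bound_def)

lemma riesz_op_bound:
  assumes c: "0 \<le> c" and le: "\<And>y. h y \<le> ennreal c * (f n y + f\<^sub>0 y)"
  shows "(\<integral>\<^sup>+x. (riesz_op \<beta> h x)\<^sup>2 \<partial>lebesgue) \<le> ennreal (bound c)"
proof -
  have "(riesz_op \<beta> h x)\<^sup>2 \<le> (ennreal c)\<^sup>2 * (2 * (riesz_op \<beta> (f n) x)\<^sup>2 + 2 * (riesz_op \<beta> f\<^sub>0 x)\<^sup>2)" for x
  proof -
    have "riesz_op \<beta> h x \<le> riesz_op \<beta> (\<lambda>y. ennreal c * (f n y + f\<^sub>0 y)) x"
      by (intro riesz_op_mono_AE AE_I2 le)
    also have "\<dots> = ennreal c * (riesz_op \<beta> (f n) x + riesz_op \<beta> f\<^sub>0 x)"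
      by (simp add: riesz_op_cmult riesz_op_add del: ennreal_plus)
    finally have "(riesz_op \<beta> h x)\<^sup>2 \<le> (ennreal c)\<^sup>2 * (riesz_op \<beta> (f n) x + riesz_op \<beta> f\<^sub>0 x)\<^sup>2"
      using power_mono_ennreal by (metis power_mult_distrib)
    also have "\<dots> \<le> (ennreal c)\<^sup>2 * (2 * (riesz_op \<beta> (f n) x)\<^sup>2 + 2 * (riesz_op \<beta> f\<^sub>0 x)\<^sup>2)"
      by (intro mult_left_mono power2_sum_le_ennreal) simp
    finally show ?thesis .
  qed
  then have "(\<integral>\<^sup>+x. (riesz_op \<beta> h x)\<^sup>2 \<partial>lebesgue)
      \<le> (\<integral>\<^sup>+x. (ennreal c)\<^sup>2 * (2 * (riesz_op \<beta> (f n) x)\<^sup>2 + 2 * (riesz_op \<beta> f\<^sub>0 x)\<^sup>2) \<partial>lebesgue)"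
    by (intro nn_integral_mono)
  also have "\<dots> = (ennreal c)\<^sup>2 * (2 * (\<integral>\<^sup>+x. (riesz_op \<beta> (f n) x)\<^sup>2 \<partial>lebesgue)
      + 2 * (\<integral>\<^sup>+x. (riesz_op \<beta> f\<^sub>0 x)\<^sup>2 \<partial>lebesgue))"
    by (simp add: nn_integral_cmult nn_integral_add)
  also have "\<dots> \<le> (ennreal c)\<^sup>2 * (2 * ennreal C + 2 * ennreal C)"
    by (intro mult_left_mono add_mono C riesz_op_f0_bound) auto
  also have "\<dots> = ennreal (bound c)"
  proof -
    have "2 * ennreal C + 2 * ennreal C = ennreal (4 * C)"
      using C(1) ennreal_mult[of 4 C] by (simp add: distrib_right[symmetric])
    then show ?thesis using c C(1) by (simp add: bound_def ennreal_power ennreal_mult)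
  qed
  finally show ?thesis .
qed

lemma g_le: "g n y \<le> ennreal (2 powr p) * (f n y + f\<^sub>0 y)"
proof -
  have "\<bar>U n y - u y\<bar> powr p \<le> 2 powr p * (\<bar>U n y\<bar> powr p + \<bar>u y\<bar> powr p)"
    using powr_abs_add_le[of p "U n y" "- u y"] p by simp
  then show ?thesis by (simp add: ennreal_mult[symmetric] ennreal_plus[symmetric] ennreal_leI del: ennreal_plus)
qed

lemma f_le: "f n y \<le> ennreal (2 powr p) * (g n y + f\<^sub>0 y)"
proof -
  have "\<bar>U n y\<bar> powr p \<le> 2 powr p * (\<bar>U n y - u y\<bar> powr p + \<bar>u y\<bar> powr p)"
    using powr_abs_add_le[of p "U n y - u y" "u y"] p by simp
  then show ?thesis by (simp add: ennreal_mult[symmetric] ennreal_plus[symmetric] ennreal_leI del: ennreal_plus)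
qed

lemma d_le: "d n y \<le> f n y + f\<^sub>0 y"
  by (simp only: ennreal_plus[symmetric] abs_ge_zero powr_ge_zero ennreal_leI abs_diff_bounds)

lemma f_le_d: "f n y \<le> d n y + f\<^sub>0 y"
  by (simp only: ennreal_plus[symmetric] abs_ge_zero powr_ge_zero ennreal_leI abs_diff_bounds)

lemma f0_le_d: "f\<^sub>0 y \<le> d n y + f n y"
  by (simp only: ennreal_plus[symmetric] abs_ge_zero powr_ge_zero ennreal_leI abs_diff_bounds)

lemma riesz_op_g_bound: "(\<integral>\<^sup>+x. (riesz_op \<beta> (g n) x)\<^sup>2 \<partial>lebesgue) \<le> ennreal (bound (2 powr p))"
  by (rule riesz_op_bound[OF _ g_le]) simp

lemma riesz_op_d_bound: "(\<integral>\<^sup>+x. (riesz_op \<beta> (d n) x)\<^sup>2 \<partial>lebesgue) \<le> ennreal (bound 1)"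
  by (rule riesz_op_bound[of _ _ n]) (use d_le[of n] in simp_all)

lemma riesz_op_L2_finite:
  "(\<integral>\<^sup>+x. (riesz_op \<beta> (f n) x)\<^sup>2 \<partial>lebesgue) < \<infinity>"
  "(\<integral>\<^sup>+x. (riesz_op \<beta> f\<^sub>0 x)\<^sup>2 \<partial>lebesgue) < \<infinity>"
  "(\<integral>\<^sup>+x. (riesz_op \<beta> (g n) x)\<^sup>2 \<partial>lebesgue) < \<infinity>"
  by (rule order.strict_trans1[OF C(2)] order.strict_trans1[OF riesz_op_f0_bound]
      order.strict_trans1[OF riesz_op_g_bound]; simp)+

lemma locally_finite:
  assumes "0 < r"
  shows "(\<integral>\<^sup>+y\<in>cball 0 r. f n y \<partial>lebesgue) < \<infinity>" "(\<integral>\<^sup>+y\<in>cball 0 r. f\<^sub>0 y \<partial>lebesgue) < \<infinity>"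
  by (intro riesz_op_locally_finite[OF order _ _ assms] riesz_op_L2_finite; measurable)+

lemma g_null: "AE x in lebesgue. (\<lambda>n. g n x) \<longlonglongrightarrow> 0"
  using lim
proof eventually_elim
  case (elim x)
  have "(\<lambda>n. \<bar>U n x - u x\<bar> powr p) \<longlonglongrightarrow> \<bar>u x - u x\<bar> powr p"
    using elim p by (intro tendsto_powr' tendsto_intros) auto
  then show ?case using p by (simp add: tendsto_ennrealI flip: ennreal_0)
qed

lemma d_null: "AE x in lebesgue. (\<lambda>n. d n x) \<longlonglongrightarrow> 0"
  using lim
proof eventually_elim
  case (elim x)
  have "(\<lambda>n. \<bar>\<bar>U n x\<bar> powr p - \<bar>u x\<bar> powr p\<bar>) \<longlonglongrightarrow> \<bar>\<bar>u x\<bar> powr p - \<bar>u x\<bar> powr p\<bar>"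
    using elim p by (intro tendsto_rabs tendsto_diff tendsto_powr' tendsto_const) auto
  then show ?case by (simp add: tendsto_ennrealI flip: ennreal_0)
qed

definition locally_null :: "(nat \<Rightarrow> 'a \<Rightarrow> ennreal) \<Rightarrow> bool" where
  "locally_null h \<longleftrightarrow> (\<forall>r>0. (\<lambda>n. \<integral>\<^sup>+y\<in>cball 0 r. h n y \<partial>lebesgue) \<longlonglongrightarrow> 0)"

text \<open>
  With \<open>f\<^sub>0\<close> locally integrable, the sequence \<open>a k n + b f\<^sub>0\<close> is an admissible family of dominating functions on
  each ball: its integrals converge because \<open>k\<close> is locally null.
\<close>

lemma locally_null_transfer:
  assumes [measurable]: "\<And>n. h n \<in> borel_measurable lebesgue" "\<And>n. k n \<in> borel_measurable lebesgue"
    and k: "locally_null k"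
    and null: "AE x in lebesgue. (\<lambda>n. h n x) \<longlonglongrightarrow> 0" "AE x in lebesgue. (\<lambda>n. k n x) \<longlonglongrightarrow> 0"
    and le: "\<And>n y. h n y \<le> ennreal a * k n y + ennreal b * f\<^sub>0 y"
  shows "locally_null h"
  unfolding locally_null_def
proof (intro allI impI)
  fix r :: real assume r: "0 < r"
  let ?B = "indicator (cball 0 r) :: 'a \<Rightarrow> ennreal"
  let ?f = "\<lambda>y. ennreal b * (f\<^sub>0 y * ?B y)"
  show "(\<lambda>n. \<integral>\<^sup>+y. h n y * ?B y \<partial>lebesgue) \<longlonglongrightarrow> 0"
  proof (rule nn_integral_null_convergent_dominators
      [where G = "\<lambda>n y. ennreal a * (k n y * ?B y) + ?f y" and g = ?f])
    show "AE y in lebesgue. h n y * ?B y \<le> ennreal a * (k n y * ?B y) + ?f y" for n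
      using le by (auto split: split_indicator)
    show "AE x in lebesgue. (\<lambda>n. h n x * ?B x) \<longlonglongrightarrow> 0"
      using null(1) by (auto elim!: eventually_mono split: split_indicator)
    show "AE x in lebesgue. (\<lambda>n. ennreal a * (k n x * ?B x) + ?f x) \<longlonglongrightarrow> ?f x"
      using null(2)
    proof eventually_elim
      case (elim x)
      have "(\<lambda>n. ennreal a * (k n x * ?B x) + ?f x) \<longlonglongrightarrow> 0 + ?f x"
        using elim by (intro tendsto_add tendsto_const ennreal_tendsto_0_cmult) (auto split: split_indicator)
      then show ?case by simp
    qed
    have "(\<lambda>n. ennreal a * (\<integral>\<^sup>+y. k n y * ?B y \<partial>lebesgue) + (\<integral>\<^sup>+y. ?f y \<partial>lebesgue))
        \<longlonglongrightarrow> 0 + (\<integral>\<^sup>+y. ?f y \<partial>lebesgue)"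
      using k r by (intro tendsto_add tendsto_const ennreal_tendsto_0_cmult) (auto simp: locally_null_def)
    then show "(\<lambda>n. \<integral>\<^sup>+y. ennreal a * (k n y * ?B y) + ?f y \<partial>lebesgue) \<longlonglongrightarrow> (\<integral>\<^sup>+y. ?f y \<partial>lebesgue)"
      by (simp add: nn_integral_add nn_integral_cmult)
    show "(\<integral>\<^sup>+y. ?f y \<partial>lebesgue) < \<infinity>"
      using locally_finite(2)[OF r] by (simp add: nn_integral_cmult ennreal_mult_less_top)
  qed measurable
qed

lemma locally_null_d_iff_g: "locally_null d \<longleftrightarrow> locally_null g"
proof
  assume "locally_null d"
  then show "locally_null g"
  proof (rule locally_null_transfer[rotated 2, OF _ g_null d_null])
    fix n y
    have "g n y \<le> ennreal (2 powr p) * (f n y + f\<^sub>0 y)" by (rule g_le)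
    also have "\<dots> \<le> ennreal (2 powr p) * ((d n y + f\<^sub>0 y) + f\<^sub>0 y)"
      by (intro mult_left_mono add_mono f_le_d order.refl) simp
    also have "\<dots> = ennreal (2 powr p) * d n y + ennreal (2 powr p * 2) * f\<^sub>0 y"
    proof -
      have "ennreal (2 powr p * 2) = ennreal (2 powr p) * 2" by (subst ennreal_mult) auto
      then show ?thesis by (simp only: distrib_left distrib_right mult_2_right add.assoc)
    qed
    finally show "g n y \<le> ennreal (2 powr p) * d n y + ennreal (2 powr p * 2) * f\<^sub>0 y" .
  qed measurable
next
  assume "locally_null g"
  then show "locally_null d"
  proof (rule locally_null_transfer[rotated 2, OF _ d_null g_null])
    fix n y
    have "d n y \<le> f n y + f\<^sub>0 y" by (rule d_le)
    also have "\<dots> \<le> ennreal (2 powr p) * (g n y + f\<^sub>0 y) + f\<^sub>0 y"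
      by (intro add_mono f_le order.refl)
    also have "\<dots> = ennreal (2 powr p) * g n y + ennreal (2 powr p + 1) * f\<^sub>0 y"
    proof -
      have "ennreal (2 powr p + 1) = ennreal (2 powr p) + 1" by (subst ennreal_plus) auto
      then show ?thesis by (simp only: distrib_left distrib_right mult_1 add.assoc)
    qed
    finally show "d n y \<le> ennreal (2 powr p) * g n y + ennreal (2 powr p + 1) * f\<^sub>0 y" .
  qed measurable
qed

end

section \<open>Test functions with compact support\<close>

lemma ennreal_abs_diff_le:
  fixes a b c :: ennreal
  assumes "a \<le> c + b" "b \<le> c + a" "a < \<infinity>" "b < \<infinity>"
  shows "ennreal \<bar>enn2real a - enn2real b\<bar> \<le> c"
proof (cases c)
  case (real z)
  obtain x y where xy: "a = ennreal x" "0 \<le> x" "b = ennreal y" "0 \<le> y"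
    using assms(3,4) by (cases a; cases b) auto
  have "x \<le> z + y" "y \<le> z + x"
    using assms(1,2) xy real by (simp_all add: ennreal_plus[symmetric] del: ennreal_plus)
  then have "\<bar>x - y\<bar> \<le> z" by simp
  then show ?thesis using xy real by (simp add: ennreal_leI)
qed simp

lemma Cc_bounds:
  fixes \<phi> :: "'a::euclidean_space \<Rightarrow> real"
  assumes "\<phi> \<in> Cc"
  obtains r M where "0 < r" "0 \<le> M" "\<And>x. \<bar>\<phi> x\<bar> \<le> M * indicator (cball 0 r) x"
proof -
  have c: "continuous_on UNIV \<phi>" and k: "compact (closure (support_on UNIV \<phi>))"
    using assms by (auto simp: Cc_def)
  obtain r where r: "0 < r" "\<And>x. x \<in> closure (support_on UNIV \<phi>) \<Longrightarrow> norm x \<le> r"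
    using compact_imp_bounded[OF k] by (auto simp: bounded_pos)
  have "bounded (\<phi> ` cball 0 r)"
    by (intro compact_imp_bounded compact_continuous_image continuous_on_subset[OF c]) auto
  then obtain M where M: "0 < M" "\<And>x. x \<in> cball 0 r \<Longrightarrow> \<bar>\<phi> x\<bar> \<le> M"
    by (auto simp: bounded_pos)
  have "\<bar>\<phi> x\<bar> \<le> M * indicator (cball 0 r) x" for x
  proof (cases "x \<in> cball 0 r")
    case False
    then have "x \<notin> closure (support_on UNIV \<phi>)" using r(2)[of x] by auto
    then have "x \<notin> support_on UNIV \<phi>" using closure_subset by blast
    with False show ?thesis by (simp add: in_support_on)
  qed (use M in simp)
  then show ?thesis using r(1) M(1) by (intro that[of r M]) auto
qed

lemma Cc_measurable:
  fixes \<phi> :: "'a::euclidean_space \<Rightarrow> real"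
  assumes "\<phi> \<in> Cc"
  shows "\<phi> \<in> borel_measurable lebesgue"
  using assms by (auto simp: Cc_def intro!: measurable_completion borel_measurable_continuous_onI)

lemma Cc_cutoff:
  assumes "0 < r"
  shows "(\<lambda>x::'a::euclidean_space. max 0 (min 1 (r + 1 - norm x))) \<in> Cc"
proof -
  have "support_on UNIV (\<lambda>x::'a. max 0 (min 1 (r + 1 - norm x))) \<subseteq> cball 0 (r + 1)"
  proof
    fix x :: 'a assume "x \<in> support_on UNIV (\<lambda>x. max 0 (min 1 (r + 1 - norm x)))"
    then have "max 0 (min 1 (r + 1 - norm x)) \<noteq> 0" by (simp add: in_support_on)
    then have "norm x \<le> r + 1" by linarith
    then show "x \<in> cball 0 (r + 1)" by simp
  qed
  then have "bounded (support_on UNIV (\<lambda>x::'a. max 0 (min 1 (r + 1 - norm x))))"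
    by (rule bounded_subset[OF bounded_cball])
  then have "compact (closure (support_on UNIV (\<lambda>x::'a. max 0 (min 1 (r + 1 - norm x)))))"
    by simp
  then show ?thesis by (auto simp: Cc_def intro!: continuous_intros)
qed

lemma nn_integral_mult_Cc_le:
  fixes \<phi> :: "'a::euclidean_space \<Rightarrow> real"
  assumes "\<And>x. \<bar>\<phi> x\<bar> \<le> M * indicator (cball 0 r) x" "0 \<le> M" and [measurable]: "h \<in> borel_measurable lebesgue"
  shows "(\<integral>\<^sup>+x. ennreal \<bar>\<phi> x * h x\<bar> \<partial>lebesgue) \<le> ennreal M * (\<integral>\<^sup>+x\<in>cball 0 r. ennreal \<bar>h x\<bar> \<partial>lebesgue)"
proof -
  have "(\<integral>\<^sup>+x. ennreal \<bar>\<phi> x * h x\<bar> \<partial>lebesgue)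
      \<le> (\<integral>\<^sup>+x. ennreal M * (ennreal \<bar>h x\<bar> * indicator (cball 0 r) x) \<partial>lebesgue)"
  proof (intro nn_integral_mono)
    fix x
    have "\<bar>\<phi> x * h x\<bar> \<le> (M * indicator (cball 0 r) x) * \<bar>h x\<bar>"
      unfolding abs_mult by (intro mult_right_mono assms abs_ge_zero)
    then have "ennreal \<bar>\<phi> x * h x\<bar> \<le> ennreal ((M * indicator (cball 0 r) x) * \<bar>h x\<bar>)"
      by (rule ennreal_leI)
    then show "ennreal \<bar>\<phi> x * h x\<bar> \<le> ennreal M * (ennreal \<bar>h x\<bar> * indicator (cball 0 r) x)"
      using assms(2) by (auto simp: ennreal_mult split: split_indicator_asm)
  qed
  then show ?thesis by (simp add: nn_integral_cmult)
qed

context riesz_bounded_sequence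
begin

lemma converges_in_Lp_loc_iff: "converges_in_Lp_loc p U u \<longleftrightarrow> locally_null g"
proof -
  have ball: "\<exists>r>0. K \<subseteq> cball 0 r" if "compact K" for K :: "'a set"
    using compact_imp_bounded[OF that] by (auto simp: bounded_pos subset_iff)
  have mono: "(\<integral>\<^sup>+y\<in>K. h y \<partial>lebesgue) \<le> (\<integral>\<^sup>+y\<in>cball 0 r. h y \<partial>lebesgue)"
    if "K \<subseteq> cball 0 r" for K r and h :: "'a \<Rightarrow> ennreal"
    using that by (intro nn_integral_mono) (auto split: split_indicator)
  have "in_Lp_loc p (U n)" for n
    unfolding in_Lp_loc_def
  proof (intro conjI allI impI U)
    fix K :: "'a set" assume "compact K"
    then obtain r where "0 < r" "K \<subseteq> cball 0 r" using ball by blast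
    then show "(\<integral>\<^sup>+x\<in>K. f n x \<partial>lebesgue) < \<infinity>"
      by (intro order.strict_trans1[OF mono locally_finite(1)])
  qed
  moreover have "in_Lp_loc p u"
    unfolding in_Lp_loc_def
  proof (intro conjI allI impI borel_measurable_limit)
    fix K :: "'a set" assume "compact K"
    then obtain r where "0 < r" "K \<subseteq> cball 0 r" using ball by blast
    then show "(\<integral>\<^sup>+x\<in>K. f\<^sub>0 x \<partial>lebesgue) < \<infinity>"
      by (intro order.strict_trans1[OF mono locally_finite(2)])
  qed
  moreover have "(\<forall>K. compact K \<longrightarrow> (\<lambda>n. \<integral>\<^sup>+x\<in>K. g n x \<partial>lebesgue) \<longlonglongrightarrow> 0) \<longleftrightarrow> locally_null g"
  proof (intro iffI allI impI)
    assume *: "\<forall>K. compact K \<longrightarrow> (\<lambda>n. \<integral>\<^sup>+x\<in>K. g n x \<partial>lebesgue) \<longlonglongrightarrow> 0"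
    show "locally_null g"
      unfolding locally_null_def by (intro allI impI *[rule_format] compact_cball)
  next
    fix K :: "'a set" assume null: "locally_null g" and "compact K"
    then obtain r where r: "0 < r" "K \<subseteq> cball 0 r" using ball by blast
    show "(\<lambda>n. \<integral>\<^sup>+x\<in>K. g n x \<partial>lebesgue) \<longlonglongrightarrow> 0"
    proof (rule ennreal_tendsto_0_le)
      show "(\<lambda>n. \<integral>\<^sup>+x\<in>cball 0 r. g n x \<partial>lebesgue) \<longlonglongrightarrow> 0"
        using null r(1) by (simp add: locally_null_def)
    qed (rule mono[OF r(2)])
  qed
  ultimately show ?thesis by (simp add: converges_in_Lp_loc_def)
qed

lemma Cc_integrable:
  assumes "\<phi> \<in> Cc"
  shows "integrable lebesgue (\<lambda>x. \<phi> x * \<bar>U n x\<bar> powr p)" "integrable lebesgue (\<lambda>x. \<phi> x * \<bar>u x\<bar> powr p)"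
proof -
  obtain r M where rM: "0 < r" "0 \<le> M" "\<And>x. \<bar>\<phi> x\<bar> \<le> M * indicator (cball 0 r) x"
    using Cc_bounds[OF assms] by blast
  have [measurable]: "\<phi> \<in> borel_measurable lebesgue" by (rule Cc_measurable[OF assms])
  have int: "integrable lebesgue (\<lambda>x. \<phi> x * h x)"
    if [measurable]: "h \<in> borel_measurable lebesgue"
      and "(\<integral>\<^sup>+x\<in>cball 0 r. ennreal \<bar>h x\<bar> \<partial>lebesgue) < \<infinity>" for h
  proof (rule integrableI_bounded)
    show "(\<integral>\<^sup>+x. ennreal (norm (\<phi> x * h x)) \<partial>lebesgue) < \<infinity>"
      unfolding real_norm_def
      using that(2) by (intro order.strict_trans1[OF nn_integral_mult_Cc_le[OF rM(3,2) that(1)]])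
        (simp add: ennreal_mult_less_top)
  qed measurable
  show "integrable lebesgue (\<lambda>x. \<phi> x * \<bar>U n x\<bar> powr p)"
    using locally_finite(1)[OF rM(1), of n] by (intro int) simp_all
  show "integrable lebesgue (\<lambda>x. \<phi> x * \<bar>u x\<bar> powr p)"
    using locally_finite(2)[OF rM(1)] by (intro int) simp_all
qed

text \<open>
  A cutoff function that equals \<open>1\<close> on a ball turns vague convergence into convergence of the
  integrals of the dominating functions \<open>\<phi> (f n + f\<^sub>0)\<close> of \<open>\<phi> d n\<close>. Conversely, a test function is a bounded
  multiple of the indicator of a ball.
\<close>

lemma converges_in_measures_iff:
  "converges_in_measures (\<lambda>n x. \<bar>U n x\<bar> powr p) (\<lambda>x. \<bar>u x\<bar> powr p) \<longleftrightarrow> locally_null d"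
proof
  assume null: "locally_null d"
  show "converges_in_measures (\<lambda>n x. \<bar>U n x\<bar> powr p) (\<lambda>x. \<bar>u x\<bar> powr p)"
    unfolding converges_in_measures_def
  proof (intro ballI conjI allI Cc_integrable)
    fix \<phi> :: "'a \<Rightarrow> real" assume \<phi>: "\<phi> \<in> Cc"
    obtain r M where rM: "0 < r" "0 \<le> M" "\<And>x. \<bar>\<phi> x\<bar> \<le> M * indicator (cball 0 r) x"
      using Cc_bounds[OF \<phi>] by blast
    show "(\<lambda>n. \<integral>x. \<phi> x * \<bar>U n x\<bar> powr p \<partial>lebesgue) \<longlonglongrightarrow> (\<integral>x. \<phi> x * \<bar>u x\<bar> powr p \<partial>lebesgue)"
    proof (rule tendsto_L1_int[OF Cc_integrable[OF \<phi>]])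
      show "(\<lambda>n. \<integral>\<^sup>+x. ennreal (norm (\<phi> x * \<bar>U n x\<bar> powr p - \<phi> x * \<bar>u x\<bar> powr p)) \<partial>lebesgue) \<longlonglongrightarrow> 0"
      proof (rule ennreal_tendsto_0_le)
        show "(\<lambda>n. ennreal M * (\<integral>\<^sup>+x\<in>cball 0 r. d n x \<partial>lebesgue)) \<longlonglongrightarrow> 0"
          using null rM(1) by (intro ennreal_tendsto_0_cmult) (auto simp: locally_null_def)
        show "(\<integral>\<^sup>+x. ennreal (norm (\<phi> x * \<bar>U n x\<bar> powr p - \<phi> x * \<bar>u x\<bar> powr p)) \<partial>lebesgue)
            \<le> ennreal M * (\<integral>\<^sup>+x\<in>cball 0 r. d n x \<partial>lebesgue)" for n
          unfolding right_diff_distrib[symmetric] real_norm_def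
          by (intro nn_integral_mult_Cc_le rM) measurable
      qed
    qed
  qed
next
  assume conv: "converges_in_measures (\<lambda>n x. \<bar>U n x\<bar> powr p) (\<lambda>x. \<bar>u x\<bar> powr p)"
  show "locally_null d"
    unfolding locally_null_def
  proof (intro allI impI)
    fix r :: real assume r: "0 < r"
    define \<phi> :: "'a \<Rightarrow> real" where "\<phi> x = max 0 (min 1 (r + 1 - norm x))" for x
    have \<phi>: "\<phi> \<in> Cc" unfolding \<phi>_def[abs_def] by (rule Cc_cutoff[OF r])
    have \<phi>0: "0 \<le> \<phi> x" for x by (simp add: \<phi>_def)
    have [measurable]: "\<phi> \<in> borel_measurable lebesgue" by (rule Cc_measurable[OF \<phi>])
    have nn: "(\<integral>\<^sup>+x. ennreal (\<phi> x) * f n x \<partial>lebesgue) = ennreal (\<integral>x. \<phi> x * \<bar>U n x\<bar> powr p \<partial>lebesgue)"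
      "(\<integral>\<^sup>+x. ennreal (\<phi> x) * f\<^sub>0 x \<partial>lebesgue) = ennreal (\<integral>x. \<phi> x * \<bar>u x\<bar> powr p \<partial>lebesgue)" for n
      using nn_integral_eq_integral[OF Cc_integrable(1)[OF \<phi>, of n]]
        nn_integral_eq_integral[OF Cc_integrable(2)[OF \<phi>]] \<phi>0
      by (simp_all add: ennreal_mult)
    have lim: "(\<lambda>n. \<integral>\<^sup>+x. ennreal (\<phi> x) * f n x \<partial>lebesgue) \<longlonglongrightarrow> (\<integral>\<^sup>+x. ennreal (\<phi> x) * f\<^sub>0 x \<partial>lebesgue)"
      using conv \<phi> unfolding nn converges_in_measures_def by (intro tendsto_ennrealI) blast
    have "(\<lambda>n. \<integral>\<^sup>+x. ennreal (\<phi> x) * d n x \<partial>lebesgue) \<longlonglongrightarrow> 0"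
    proof (rule nn_integral_null_convergent_dominators
        [where G = "\<lambda>n x. ennreal (\<phi> x) * (f n x + f\<^sub>0 x)" and g = "\<lambda>x. ennreal (\<phi> x) * (f\<^sub>0 x + f\<^sub>0 x)"])
      show "AE x in lebesgue. ennreal (\<phi> x) * d n x \<le> ennreal (\<phi> x) * (f n x + f\<^sub>0 x)" for n
        by (intro AE_I2 mult_left_mono d_le) simp
      show "AE x in lebesgue. (\<lambda>n. ennreal (\<phi> x) * d n x) \<longlonglongrightarrow> 0"
        using d_null by eventually_elim (intro ennreal_tendsto_0_cmult, auto)
      show "AE x in lebesgue. (\<lambda>n. ennreal (\<phi> x) * (f n x + f\<^sub>0 x)) \<longlonglongrightarrow> ennreal (\<phi> x) * (f\<^sub>0 x + f\<^sub>0 x)"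
        using f_lim
      proof eventually_elim
        case (elim x)
        then show ?case by (intro ennreal_tendsto_cmult tendsto_add tendsto_const) simp_all
      qed
      show "(\<lambda>n. \<integral>\<^sup>+x. ennreal (\<phi> x) * (f n x + f\<^sub>0 x) \<partial>lebesgue)
          \<longlonglongrightarrow> (\<integral>\<^sup>+x. ennreal (\<phi> x) * (f\<^sub>0 x + f\<^sub>0 x) \<partial>lebesgue)"
        using tendsto_add[OF lim tendsto_const[of "\<integral>\<^sup>+x. ennreal (\<phi> x) * f\<^sub>0 x \<partial>lebesgue"]]
        by (simp add: distrib_left nn_integral_add del: ennreal_plus)
      show "(\<integral>\<^sup>+x. ennreal (\<phi> x) * (f\<^sub>0 x + f\<^sub>0 x) \<partial>lebesgue) < \<infinity>"
        by (simp add: distrib_left nn_integral_add nn del: ennreal_plus)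
    qed measurable
    then show "(\<lambda>n. \<integral>\<^sup>+y\<in>cball 0 r. d n y \<partial>lebesgue) \<longlonglongrightarrow> 0"
    proof (rule ennreal_tendsto_0_le)
      show "(\<integral>\<^sup>+y\<in>cball 0 r. d n y \<partial>lebesgue) \<le> (\<integral>\<^sup>+x. ennreal (\<phi> x) * d n x \<partial>lebesgue)" for n
        by (intro nn_integral_mono) (auto simp: \<phi>_def split: split_indicator)
    qed
  qed
qed

section \<open>Weak convergence of the potentials\<close>

lemma riesz_potential_eq:
  fixes h :: "'a \<Rightarrow> real"
  shows "riesz_potential \<beta> (\<lambda>y. h y) = (\<lambda>x. enn2real (riesz_op \<beta> (\<lambda>y. ennreal (h y)) x))"
  by (simp add: fun_eq_iff riesz_potential_def riesz_conv_eq_riesz_op[OF order])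

abbreviation F :: "nat \<Rightarrow> 'a \<Rightarrow> real" where "F n x \<equiv> enn2real (riesz_op \<beta> (f n) x)"
abbreviation F\<^sub>0 :: "'a \<Rightarrow> real" where "F\<^sub>0 x \<equiv> enn2real (riesz_op \<beta> f\<^sub>0 x)"
abbreviation G :: "nat \<Rightarrow> 'a \<Rightarrow> real" where "G n x \<equiv> enn2real (riesz_op \<beta> (g n) x)"

lemma potentials_L2: "F n \<in> L2" "F\<^sub>0 \<in> L2" "G n \<in> L2"
  by (intro enn2real_L2(1) riesz_op_L2_finite; measurable)+

lemma potentials_finite:
  "AE x in lebesgue. riesz_op \<beta> (f n) x < \<infinity>"
  "AE x in lebesgue. riesz_op \<beta> f\<^sub>0 x < \<infinity>"
  "AE x in lebesgue. riesz_op \<beta> (g n) x < \<infinity>"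
  by (intro AE_finite_of_L2 riesz_op_L2_finite; measurable)+

text \<open>
  Since \<open>|T f\<^sub>n - T f\<^sub>0| \<le> T |f\<^sub>n - f\<^sub>0|\<close>, it suffices that the potentials of \<open>d n\<close> tend weakly to zero.
\<close>

lemma converges_weakly_of_locally_null:
  assumes "locally_null d"
  shows "converges_weakly_L2 F F\<^sub>0"
  unfolding converges_weakly_L2_def
proof (intro conjI allI ballI potentials_L2)
  fix w :: "'a \<Rightarrow> real" assume w: "w \<in> L2"
  have [measurable]: "w \<in> borel_measurable lebesgue" using w by (simp add: L2_def)
  show "(\<lambda>n. \<integral>x. F n x * w x \<partial>lebesgue) \<longlonglongrightarrow> (\<integral>x. F\<^sub>0 x * w x \<partial>lebesgue)"
  proof (rule tendsto_L1_int[OF integrable_mult_L2[OF potentials_L2(1) w] integrable_mult_L2[OF potentials_L2(2) w]])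
    show "(\<lambda>n. \<integral>\<^sup>+x. ennreal (norm (F n x * w x - F\<^sub>0 x * w x)) \<partial>lebesgue) \<longlonglongrightarrow> 0"
    proof (rule ennreal_tendsto_0_le)
      have "(\<integral>\<^sup>+x. (ennreal \<bar>w x\<bar>)\<^sup>2 \<partial>lebesgue) = (\<integral>\<^sup>+x. ennreal ((w x)\<^sup>2) \<partial>lebesgue)"
        by (simp add: ennreal_power)
      also have "\<dots> < \<infinity>" using w nn_integral_eq_integral[of lebesgue "\<lambda>x. (w x)\<^sup>2"] by (simp add: L2_def)
      finally show "(\<lambda>n. \<integral>\<^sup>+x. ennreal \<bar>w x\<bar> * riesz_op \<beta> (d n) x \<partial>lebesgue) \<longlonglongrightarrow> 0"
        using assms by (intro riesz_op_weakly_null[OF order _ bound_nonneg riesz_op_d_bound])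
          (auto simp: locally_null_def)
      show "(\<integral>\<^sup>+x. ennreal (norm (F n x * w x - F\<^sub>0 x * w x)) \<partial>lebesgue)
          \<le> (\<integral>\<^sup>+x. ennreal \<bar>w x\<bar> * riesz_op \<beta> (d n) x \<partial>lebesgue)" for n
      proof (rule nn_integral_mono_AE)
        show "AE x in lebesgue. ennreal (norm (F n x * w x - F\<^sub>0 x * w x)) \<le> ennreal \<bar>w x\<bar> * riesz_op \<beta> (d n) x"
          using potentials_finite(1)[of n] potentials_finite(2)
        proof eventually_elim
          case (elim x)
          have "ennreal \<bar>F n x - F\<^sub>0 x\<bar> \<le> riesz_op \<beta> (d n) x"
          proof (rule ennreal_abs_diff_le)
            show "riesz_op \<beta> (f n) x \<le> riesz_op \<beta> (d n) x + riesz_op \<beta> f\<^sub>0 x"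
              by (subst riesz_op_add[symmetric]) (measurable, intro riesz_op_mono_AE AE_I2 f_le_d)
            show "riesz_op \<beta> f\<^sub>0 x \<le> riesz_op \<beta> (d n) x + riesz_op \<beta> (f n) x"
              by (subst riesz_op_add[symmetric]) (measurable, intro riesz_op_mono_AE AE_I2 f0_le_d)
          qed (use elim in auto)
          then have "ennreal \<bar>w x\<bar> * ennreal \<bar>F n x - F\<^sub>0 x\<bar> \<le> ennreal \<bar>w x\<bar> * riesz_op \<beta> (d n) x"
            by (rule mult_left_mono) simp
          moreover have "norm (F n x * w x - F\<^sub>0 x * w x) = \<bar>w x\<bar> * \<bar>F n x - F\<^sub>0 x\<bar>"
            unfolding left_diff_distrib[symmetric] real_norm_def abs_mult by (rule mult.commute)
          ultimately show ?case by (simp only: ennreal_mult abs_ge_zero)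
        qed
      qed
    qed
  qed
qed

text \<open>
  Let \<open>k n\<close> and \<open>m n\<close> be the positive and negative parts of \<open>f n - f\<^sub>0\<close>, so that \<open>f n + m n = f\<^sub>0 + k n\<close>. The
  negative part is dominated by \<open>f\<^sub>0\<close>, hence its potential tends to zero in \<open>L\<^sup>2\<close>. Testing the identity
  of potentials with the indicator of a ball then shows that the mean of the potential of \<open>k n\<close>
  over the ball tends to zero.
\<close>

lemma locally_null_of_converges_weakly:
  assumes weak: "converges_weakly_L2 F F\<^sub>0"
  shows "locally_null d"
  unfolding locally_null_def
proof (intro allI impI)
  fix r :: real assume r: "0 < r"
  let ?B = "cball (0::'a) r"
  \<comment> \<open>As negative reals are sent to \<open>0\<close>, these are positive parts.\<close>
  define k where "k n y = ennreal (\<bar>U n y\<bar> powr p - \<bar>u y\<bar> powr p)" for n y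
  define m where "m n y = ennreal (\<bar>u y\<bar> powr p - \<bar>U n y\<bar> powr p)" for n y
  have [measurable]: "k n \<in> borel_measurable lebesgue" "m n \<in> borel_measurable lebesgue" for n
    unfolding k_def[abs_def] m_def[abs_def] by measurable
  have split: "ennreal a + ennreal (b - a) = ennreal b + ennreal (a - b)"
      "ennreal \<bar>a - b\<bar> = ennreal (a - b) + ennreal (b - a)"
      if "0 \<le> a" "0 \<le> b" for a b :: real
    using that by (cases "a \<le> b"; simp add: ennreal_neg ennreal_plus[symmetric] del: ennreal_plus)+
  have fm: "riesz_op \<beta> (f n) x + riesz_op \<beta> (m n) x = riesz_op \<beta> f\<^sub>0 x + riesz_op \<beta> (k n) x" for n x
  proof -
    have "(\<lambda>y. f n y + m n y) = (\<lambda>y. f\<^sub>0 y + k n y)"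
      unfolding k_def m_def by (intro ext split powr_ge_zero)
    then have "riesz_op \<beta> (\<lambda>y. f n y + m n y) x = riesz_op \<beta> (\<lambda>y. f\<^sub>0 y + k n y) x" by simp
    then show ?thesis by (subst (asm) (1 2) riesz_op_add) measurable
  qed
  have dkm: "d n y = k n y + m n y" for n y
    unfolding k_def m_def by (intro split powr_ge_zero)
  have vol: "emeasure lebesgue ?B < \<infinity>"
    using emeasure_lborel_cball_finite[of "0::'a" r] by simp
  have sq: "(indicator ?B x)\<^sup>2 = (indicator ?B x :: real)" "(indicator ?B x)\<^sup>2 = (indicator ?B x :: ennreal)" for x
    by (simp_all split: split_indicator)
  have B: "indicator ?B \<in> (L2 :: ('a \<Rightarrow> real) set)"
    using vol by (simp add: L2_def sq)
  have nn: "(\<integral>\<^sup>+x\<in>?B. h x \<partial>lebesgue) = ennreal (\<integral>x. enn2real (h x) * indicator ?B x \<partial>lebesgue)"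
    if "(\<lambda>x. enn2real (h x)) \<in> L2" "AE x in lebesgue. h x < \<infinity>" for h :: "'a \<Rightarrow> ennreal"
  proof -
    have "(\<integral>\<^sup>+x\<in>?B. h x \<partial>lebesgue) = (\<integral>\<^sup>+x. ennreal (enn2real (h x) * indicator ?B x) \<partial>lebesgue)"
      using that(2) by (intro nn_integral_cong_AE) (auto elim!: eventually_mono split: split_indicator)
    also have "\<dots> = ennreal (\<integral>x. enn2real (h x) * indicator ?B x \<partial>lebesgue)"
      by (intro nn_integral_eq_integral integrable_mult_L2[OF that(1) B]) auto
    finally show ?thesis .
  qed
  note nnF = nn[OF potentials_L2(1) potentials_finite(1)] and nnF0 = nn[OF potentials_L2(2) potentials_finite(2)]
  have limF: "(\<lambda>n. \<integral>\<^sup>+x\<in>?B. riesz_op \<beta> (f n) x \<partial>lebesgue) \<longlonglongrightarrow> (\<integral>\<^sup>+x\<in>?B. riesz_op \<beta> f\<^sub>0 x \<partial>lebesgue)"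
    unfolding nnF nnF0 using weak B unfolding converges_weakly_L2_def by (intro tendsto_ennrealI) blast
  have "(\<lambda>n. \<integral>\<^sup>+x. (riesz_op \<beta> (m n) x)\<^sup>2 \<partial>lebesgue) \<longlonglongrightarrow> 0"
  proof (rule riesz_op_dominated_L2_null[where F = f\<^sub>0])
    show "AE x in lebesgue. m n x \<le> f\<^sub>0 x" for n
      unfolding m_def by (intro AE_I2 ennreal_leI) simp
    show "AE x in lebesgue. (\<lambda>n. m n x) \<longlonglongrightarrow> 0"
      using d_null
    proof eventually_elim
      case (elim x)
      then show ?case by (rule ennreal_tendsto_0_le) (simp only: dkm, simp)
    qed
  qed (use riesz_op_L2_finite in simp_all)
  then have "(\<lambda>n. \<integral>\<^sup>+x. riesz_op \<beta> (m n) x * indicator ?B x \<partial>lebesgue) \<longlonglongrightarrow> 0"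
  proof (rule nn_integral_mult_null[rotated 2])
    show "(\<integral>\<^sup>+x. (indicator ?B x)\<^sup>2 \<partial>lebesgue) \<le> ennreal (measure lebesgue ?B)"
      using vol emeasure_eq_ennreal_measure[of lebesgue ?B] unfolding sq by simp
  qed auto
  then have limM: "(\<lambda>n. \<integral>\<^sup>+x\<in>?B. riesz_op \<beta> (m n) x \<partial>lebesgue) \<longlonglongrightarrow> 0" .
  have limK: "(\<lambda>n. \<integral>\<^sup>+x\<in>?B. riesz_op \<beta> (k n) x \<partial>lebesgue) \<longlonglongrightarrow> 0"
  proof -
    let ?a = "\<integral>\<^sup>+x\<in>?B. riesz_op \<beta> f\<^sub>0 x \<partial>lebesgue"
    have a: "?a < \<infinity>" unfolding nnF0 by simp
    have balance: "(\<integral>\<^sup>+x\<in>?B. riesz_op \<beta> (f n) x \<partial>lebesgue) + (\<integral>\<^sup>+x\<in>?B. riesz_op \<beta> (m n) x \<partial>lebesgue)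
        = ?a + (\<integral>\<^sup>+x\<in>?B. riesz_op \<beta> (k n) x \<partial>lebesgue)" for n
    proof -
      have "(\<integral>\<^sup>+x\<in>?B. (riesz_op \<beta> (f n) x + riesz_op \<beta> (m n) x) \<partial>lebesgue)
          = (\<integral>\<^sup>+x\<in>?B. (riesz_op \<beta> f\<^sub>0 x + riesz_op \<beta> (k n) x) \<partial>lebesgue)"
        by (simp only: fm)
      then show ?thesis unfolding distrib_right by (subst (asm) (1 2) nn_integral_add) measurable
    qed
    have eq: "(\<integral>\<^sup>+x\<in>?B. riesz_op \<beta> (k n) x \<partial>lebesgue)
        = (\<integral>\<^sup>+x\<in>?B. riesz_op \<beta> (f n) x \<partial>lebesgue) + (\<integral>\<^sup>+x\<in>?B. riesz_op \<beta> (m n) x \<partial>lebesgue) - ?a" for n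
      unfolding balance using a by (intro ennreal_add_diff_cancel_left[symmetric]) auto
    have "(\<lambda>n. (\<integral>\<^sup>+x\<in>?B. riesz_op \<beta> (f n) x \<partial>lebesgue) + (\<integral>\<^sup>+x\<in>?B. riesz_op \<beta> (m n) x \<partial>lebesgue) - ?a)
        \<longlonglongrightarrow> ?a + 0 - ?a"
      using a by (intro tendsto_diff_ennreal_general tendsto_add limF limM tendsto_const) auto
    moreover have "?a + 0 - ?a = 0" using a ennreal_add_diff_cancel_left[of ?a 0] by auto
    ultimately show ?thesis unfolding eq by simp
  qed
  have one: "(\<integral>\<^sup>+x\<in>?B. 1 \<partial>lebesgue) \<noteq> 0"
  proof
    assume "(\<integral>\<^sup>+x\<in>?B. 1 \<partial>lebesgue) = 0"
    then show False
      using r emeasure_cball[of r "0::'a"] unit_ball_vol_pos[of "real DIM('a)"] by simp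
  qed
  have null: "(\<lambda>n. \<integral>\<^sup>+y\<in>?B. h n y \<partial>lebesgue) \<longlonglongrightarrow> 0"
    if "\<And>n. h n \<in> borel_measurable lebesgue"
      and "(\<lambda>n. \<integral>\<^sup>+x\<in>?B. riesz_op \<beta> (h n) x \<partial>lebesgue) \<longlonglongrightarrow> 0" for h
    by (rule riesz_op_locally_null_of_test[OF order that(1) _ r one]) (simp_all only: that(2) mult_1 borel_measurable_const)
  have "(\<integral>\<^sup>+y\<in>?B. d n y \<partial>lebesgue) = (\<integral>\<^sup>+y\<in>?B. k n y \<partial>lebesgue) + (\<integral>\<^sup>+y\<in>?B. m n y \<partial>lebesgue)" for n
    unfolding dkm distrib_right by (rule nn_integral_add) measurable
  then show "(\<lambda>n. \<integral>\<^sup>+y\<in>?B. d n y \<partial>lebesgue) \<longlonglongrightarrow> 0"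
    using tendsto_add[OF null[OF _ limK] null[OF _ limM]] by simp
qed

text \<open>
  Half the integral of the cross term in the expansion of \<open>(T g\<^sub>n + T f\<^sub>0)\<^sup>2\<close>.
\<close>

section \<open>The quadratic splitting\<close>

definition cross :: "nat \<Rightarrow> ennreal" where
  "cross n = (\<integral>\<^sup>+x. riesz_op \<beta> f\<^sub>0 x * riesz_op \<beta> (g n) x \<partial>lebesgue)"

text \<open>
  As \<open>u\<close> is not almost everywhere zero, the potential of \<open>f\<^sub>0\<close> is a test function that is positive
  everywhere and square-integrable, which is what both directions require.
\<close>

lemma cross_null_iff:
  assumes nz: "\<not> (AE x in lebesgue. u x = 0)"
  shows "cross \<longlonglongrightarrow> 0 \<longleftrightarrow> locally_null g"
proof
  assume "locally_null g"
  then show "cross \<longlonglongrightarrow> 0"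
    unfolding cross_def[abs_def] locally_null_def
    by (intro riesz_op_weakly_null[OF order _ bound_nonneg riesz_op_g_bound] riesz_op_L2_finite) auto
next
  assume cross: "cross \<longlonglongrightarrow> 0"
  have "\<not> (AE y in lebesgue. f\<^sub>0 y = 0)" using nz by (auto elim!: eventually_mono)
  then have pos: "0 < riesz_op \<beta> f\<^sub>0 x" for x by (intro riesz_op_pos[OF order]) measurable
  show "locally_null g"
    unfolding locally_null_def
  proof (intro allI impI)
    fix r :: real assume r: "0 < r"
    show "(\<lambda>n. \<integral>\<^sup>+y\<in>cball 0 r. g n y \<partial>lebesgue) \<longlonglongrightarrow> 0"
    proof (rule riesz_op_locally_null_of_test[OF order _ _ r, where G = "riesz_op \<beta> f\<^sub>0"])
      show "(\<integral>\<^sup>+x\<in>cball 0 r. riesz_op \<beta> f\<^sub>0 x \<partial>lebesgue) \<noteq> 0"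
      proof
        assume "(\<integral>\<^sup>+x\<in>cball 0 r. riesz_op \<beta> f\<^sub>0 x \<partial>lebesgue) = 0"
        then have "AE x in lebesgue. riesz_op \<beta> f\<^sub>0 x * indicator (cball 0 r) x = 0"
          by (subst (asm) nn_integral_0_iff_AE) measurable
        then have "AE x in lebesgue. x \<notin> cball (0::'a) r"
        proof eventually_elim
          case (elim x)
          with pos[of x] show ?case by (auto split: split_indicator_asm)
        qed
        with not_AE_notin_cball[OF r] show False by blast
      qed
      show "(\<lambda>n. \<integral>\<^sup>+x\<in>cball 0 r. riesz_op \<beta> f\<^sub>0 x * riesz_op \<beta> (g n) x \<partial>lebesgue) \<longlonglongrightarrow> 0"
      proof (rule ennreal_tendsto_0_le[OF cross])
        show "(\<integral>\<^sup>+x\<in>cball 0 r. riesz_op \<beta> f\<^sub>0 x * riesz_op \<beta> (g n) x \<partial>lebesgue) \<le> cross n" for n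
          unfolding cross_def by (intro nn_integral_mono) (simp split: split_indicator)
      qed
    qed measurable
  qed
qed

abbreviation e :: "nat \<Rightarrow> 'a \<Rightarrow> ennreal" where
  "e n y \<equiv> ennreal \<bar>\<bar>U n y\<bar> powr p - \<bar>U n y - u y\<bar> powr p - \<bar>u y\<bar> powr p\<bar>"

lemma riesz_op_e_null: "(\<lambda>n. \<integral>\<^sup>+x. (riesz_op \<beta> (e n) x)\<^sup>2 \<partial>lebesgue) \<longlonglongrightarrow> 0"
proof -
  have "AE x in lebesgue. (\<lambda>n. U n x - u x) \<longlonglongrightarrow> 0"
    using lim by eventually_elim (simp add: LIM_zero)
  from riesz_op_brezis_lieb_remainder[OF _ _ borel_measurable_limit this bound_nonneg riesz_op_g_bound riesz_op_L2_finite(2)] p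
  show ?thesis by simp
qed

lemma splitting_error_pointwise:
  fixes a b c :: real
  shows "a\<^sup>2 - b\<^sup>2 - c\<^sup>2 - 2 * b * c = (a - (b + c)) * (a + b + c)"
  by (simp add: power2_eq_square algebra_simps)

abbreviation D :: "nat \<Rightarrow> 'a \<Rightarrow> real" where
  "D n x \<equiv> (F n x)\<^sup>2 - (G n x)\<^sup>2 - (F\<^sub>0 x)\<^sup>2"

lemma borel_measurable_potentials [measurable]:
  "F n \<in> borel_measurable lebesgue" "F\<^sub>0 \<in> borel_measurable lebesgue" "G n \<in> borel_measurable lebesgue"
  by measurable

text \<open>
  The difference factors as \<open>(T f\<^sub>n - (T g\<^sub>n + T f\<^sub>0)) (T f\<^sub>n + T g\<^sub>n + T f\<^sub>0)\<close>. The first factor is at most \<open>T e\<^sub>n\<close>, which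
  tends to zero in \<open>L\<^sup>2\<close>, and the second is bounded in \<open>L\<^sup>2\<close>.
\<close>

lemma splitting_error_null:
  "(\<lambda>n. \<integral>\<^sup>+x. ennreal \<bar>D n x - 2 * G n x * F\<^sub>0 x\<bar> \<partial>lebesgue) \<longlonglongrightarrow> 0"
proof -
  define s where "s n y = f n y + g n y + f\<^sub>0 y" for n y
  have [measurable]: "s n \<in> borel_measurable lebesgue" for n unfolding s_def[abs_def] by measurable
  have s: "riesz_op \<beta> (s n) x = riesz_op \<beta> (f n) x + riesz_op \<beta> (g n) x + riesz_op \<beta> f\<^sub>0 x" for n x
  proof -
    have "riesz_op \<beta> (s n) x = riesz_op \<beta> (\<lambda>y. f n y + g n y) x + riesz_op \<beta> f\<^sub>0 x"
      unfolding s_def[abs_def] by (rule riesz_op_add) measurable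
    also have "riesz_op \<beta> (\<lambda>y. f n y + g n y) x = riesz_op \<beta> (f n) x + riesz_op \<beta> (g n) x"
      by (rule riesz_op_add) measurable
    finally show ?thesis .
  qed
  have s_le: "s n y \<le> ennreal (1 + 2 powr p) * (f n y + f\<^sub>0 y)" for n y
  proof -
    have "s n y = (f n y + f\<^sub>0 y) + g n y" unfolding s_def by (simp only: add_ac)
    also have "\<dots> \<le> (f n y + f\<^sub>0 y) + ennreal (2 powr p) * (f n y + f\<^sub>0 y)"
      by (intro add_left_mono g_le)
    also have "\<dots> = (1 + ennreal (2 powr p)) * (f n y + f\<^sub>0 y)"
      by (simp only: distrib_right mult_1)
    also have "1 + ennreal (2 powr p) = ennreal (1 + 2 powr p)"
      by (subst ennreal_plus) auto
    finally show ?thesis .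
  qed
  have lim: "(\<lambda>n. \<integral>\<^sup>+x. riesz_op \<beta> (e n) x * riesz_op \<beta> (s n) x \<partial>lebesgue) \<longlonglongrightarrow> 0"
  proof (rule nn_integral_mult_null[OF _ _ riesz_op_e_null bound_nonneg])
    show "(\<integral>\<^sup>+x. (riesz_op \<beta> (s n) x)\<^sup>2 \<partial>lebesgue) \<le> ennreal (bound (1 + 2 powr p))" for n
      by (rule riesz_op_bound[OF _ s_le]) (simp add: add_nonneg_nonneg)
  qed measurable
  have e_le: "f n y \<le> e n y + (g n y + f\<^sub>0 y)" "g n y + f\<^sub>0 y \<le> e n y + f n y" for n y
  proof -
    have "a \<le> \<bar>a - b - c\<bar> + (b + c)" "b + c \<le> \<bar>a - b - c\<bar> + a" for a b c :: real by auto
    then show "f n y \<le> e n y + (g n y + f\<^sub>0 y)" "g n y + f\<^sub>0 y \<le> e n y + f n y"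
      by (simp_all only: ennreal_plus[symmetric] abs_ge_zero powr_ge_zero add_nonneg_nonneg ennreal_leI)
  qed
  show ?thesis
  proof (rule ennreal_tendsto_0_le[OF lim])
    show "(\<integral>\<^sup>+x. ennreal \<bar>D n x - 2 * G n x * F\<^sub>0 x\<bar> \<partial>lebesgue)
        \<le> (\<integral>\<^sup>+x. riesz_op \<beta> (e n) x * riesz_op \<beta> (s n) x \<partial>lebesgue)" for n
    proof (rule nn_integral_mono_AE)
      show "AE x in lebesgue. ennreal \<bar>D n x - 2 * G n x * F\<^sub>0 x\<bar> \<le> riesz_op \<beta> (e n) x * riesz_op \<beta> (s n) x"
        using potentials_finite(1)[of n] potentials_finite(2) potentials_finite(3)[of n]
      proof eventually_elim
        case (elim x)
        have sum: "enn2real (riesz_op \<beta> (g n) x + riesz_op \<beta> f\<^sub>0 x) = G n x + F\<^sub>0 x"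
          using elim by (intro enn2real_plus) auto
        have "ennreal \<bar>F n x - enn2real (riesz_op \<beta> (g n) x + riesz_op \<beta> f\<^sub>0 x)\<bar> \<le> riesz_op \<beta> (e n) x"
        proof (rule ennreal_abs_diff_le)
          show "riesz_op \<beta> (f n) x \<le> riesz_op \<beta> (e n) x + (riesz_op \<beta> (g n) x + riesz_op \<beta> f\<^sub>0 x)"
          proof -
            have "riesz_op \<beta> (f n) x \<le> riesz_op \<beta> (\<lambda>y. e n y + (g n y + f\<^sub>0 y)) x"
              by (intro riesz_op_mono_AE AE_I2 e_le)
            then show ?thesis by (simp add: riesz_op_add del: ennreal_plus)
          qed
          show "riesz_op \<beta> (g n) x + riesz_op \<beta> f\<^sub>0 x \<le> riesz_op \<beta> (e n) x + riesz_op \<beta> (f n) x"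
          proof -
            have "riesz_op \<beta> (\<lambda>y. g n y + f\<^sub>0 y) x \<le> riesz_op \<beta> (\<lambda>y. e n y + f n y) x"
              by (intro riesz_op_mono_AE AE_I2 e_le)
            then show ?thesis by (simp add: riesz_op_add del: ennreal_plus)
          qed
        qed (use elim in auto)
        then have diff: "ennreal \<bar>F n x - (G n x + F\<^sub>0 x)\<bar> \<le> riesz_op \<beta> (e n) x"
          unfolding sum .
        have "ennreal (F n x + G n x + F\<^sub>0 x) = riesz_op \<beta> (s n) x"
          unfolding s using elim by simp
        moreover have "\<bar>D n x - 2 * G n x * F\<^sub>0 x\<bar> = \<bar>F n x - (G n x + F\<^sub>0 x)\<bar> * (F n x + G n x + F\<^sub>0 x)"
          unfolding splitting_error_pointwise abs_mult by (subst (2) abs_of_nonneg) auto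
        ultimately show ?case
          using mult_right_mono[OF diff, of "riesz_op \<beta> (s n) x"] by (simp add: ennreal_mult)
      qed
    qed
  qed
qed

lemma GF_integral: "(\<integral>\<^sup>+x. ennreal (G n x * F\<^sub>0 x) \<partial>lebesgue) = cross n"
  unfolding cross_def
proof (rule nn_integral_cong_AE)
  show "AE x in lebesgue. ennreal (G n x * F\<^sub>0 x) = riesz_op \<beta> f\<^sub>0 x * riesz_op \<beta> (g n) x"
    using potentials_finite(2) potentials_finite(3)[of n]
    by eventually_elim (simp add: ennreal_mult mult.commute)
qed

text \<open>
  Up to an error that vanishes in \<open>L\<^sup>1\<close>, the integrand is the nonnegative function \<open>2 (T g\<^sub>n) (T f\<^sub>0)\<close>, so
  taking absolute values loses nothing in the limit.
\<close>

lemma strong_splitting_iff: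
  "(\<lambda>n. \<integral>\<^sup>+x. ennreal \<bar>D n x\<bar> \<partial>lebesgue) \<longlonglongrightarrow> 0 \<longleftrightarrow> cross \<longlonglongrightarrow> 0"
proof -
  let ?S = "\<lambda>n. \<integral>\<^sup>+x. ennreal \<bar>D n x - 2 * G n x * F\<^sub>0 x\<bar> \<partial>lebesgue"
  let ?I = "\<lambda>n. \<integral>\<^sup>+x. ennreal \<bar>D n x\<bar> \<partial>lebesgue"
  have cross: "(\<integral>\<^sup>+x. ennreal (2 * G n x * F\<^sub>0 x) \<partial>lebesgue) = 2 * cross n" for n
    unfolding GF_integral[symmetric]
    by (subst nn_integral_cmult[symmetric]) (auto simp: ennreal_mult mult.assoc)
  have "?I n \<le> 2 * cross n + ?S n" for n
  proof -
    have "?I n \<le> (\<integral>\<^sup>+x. ennreal (2 * G n x * F\<^sub>0 x) + ennreal \<bar>D n x - 2 * G n x * F\<^sub>0 x\<bar> \<partial>lebesgue)"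
    proof (rule nn_integral_mono)
      fix x
      have key: "\<bar>z\<bar> \<le> y + \<bar>z - y\<bar>" if "0 \<le> y" for y z :: real using that by linarith
      have pos: "0 \<le> 2 * G n x * F\<^sub>0 x" by simp
      from ennreal_leI[OF key[OF pos, of "D n x"]]
      show "ennreal \<bar>D n x\<bar> \<le> ennreal (2 * G n x * F\<^sub>0 x) + ennreal \<bar>D n x - 2 * G n x * F\<^sub>0 x\<bar>"
        by (simp only: ennreal_plus pos abs_ge_zero)
    qed
    then show ?thesis by (subst (asm) nn_integral_add) (auto simp: cross)
  qed
  moreover have "2 * cross n \<le> ?I n + ?S n" for n
  proof -
    have "(\<integral>\<^sup>+x. ennreal (2 * G n x * F\<^sub>0 x) \<partial>lebesgue)
        \<le> (\<integral>\<^sup>+x. ennreal \<bar>D n x\<bar> + ennreal \<bar>D n x - 2 * G n x * F\<^sub>0 x\<bar> \<partial>lebesgue)"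
    proof (rule nn_integral_mono)
      fix x
      have "y \<le> \<bar>z\<bar> + \<bar>z - y\<bar>" for y z :: real by linarith
      from ennreal_leI[OF this, of "2 * G n x * F\<^sub>0 x" "D n x"]
      show "ennreal (2 * G n x * F\<^sub>0 x) \<le> ennreal \<bar>D n x\<bar> + ennreal \<bar>D n x - 2 * G n x * F\<^sub>0 x\<bar>"
        by (subst (asm) ennreal_plus) simp_all
    qed
    then show ?thesis unfolding cross by (subst (asm) nn_integral_add) auto
  qed
  moreover have "(\<lambda>n. 2 * cross n + ?S n) \<longlonglongrightarrow> 0" if "cross \<longlonglongrightarrow> 0"
    using tendsto_add[OF ennreal_tendsto_0_cmult[OF that, of 2] splitting_error_null] by simp
  moreover have "cross \<longlonglongrightarrow> 0" if "?I \<longlonglongrightarrow> 0" "\<And>n. 2 * cross n \<le> ?I n + ?S n"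
  proof (rule ennreal_tendsto_0_mult_cancel[OF _ _ that(2)])
    show "(\<lambda>n. ?I n + ?S n) \<longlonglongrightarrow> 0" using tendsto_add[OF that(1) splitting_error_null] by simp
  qed simp
  ultimately show ?thesis by (blast intro: ennreal_tendsto_0_le)
qed

lemma weak_splitting_iff:
  "(\<lambda>n. \<integral>x. (F n x)\<^sup>2 - (G n x)\<^sup>2 \<partial>lebesgue) \<longlonglongrightarrow> (\<integral>x. (F\<^sub>0 x)\<^sup>2 \<partial>lebesgue) \<longleftrightarrow> cross \<longlonglongrightarrow> 0"
proof -
  have int: "integrable lebesgue (\<lambda>x. (F n x)\<^sup>2)" "integrable lebesgue (\<lambda>x. (G n x)\<^sup>2)"
      "integrable lebesgue (\<lambda>x. (F\<^sub>0 x)\<^sup>2)" "integrable lebesgue (\<lambda>x. G n x * F\<^sub>0 x)" for n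
    using potentials_L2 integrable_mult_L2[OF potentials_L2(3) potentials_L2(2)] by (auto simp: L2_def)
  let ?J = "\<lambda>n. \<integral>x. (F n x)\<^sup>2 - (G n x)\<^sup>2 \<partial>lebesgue" and ?c = "\<integral>x. (F\<^sub>0 x)\<^sup>2 \<partial>lebesgue"
  let ?q = "\<lambda>n. \<integral>x. G n x * F\<^sub>0 x \<partial>lebesgue"
  have "(\<lambda>n. \<integral>x. D n x - 2 * (G n x * F\<^sub>0 x) \<partial>lebesgue) \<longlonglongrightarrow> (\<integral>x. 0 \<partial>(lebesgue :: 'a measure))"
    using splitting_error_null
    by (intro tendsto_L1_int Bochner_Integration.integrable_diff integrable_mult_right int integrable_zero)
       (simp add: mult.assoc)
  moreover have "(\<integral>x. D n x - 2 * (G n x * F\<^sub>0 x) \<partial>lebesgue) = ?J n - ?c - 2 * ?q n" for n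
    by (simp add: int)
  ultimately have lim: "(\<lambda>n. ?J n - ?c - 2 * ?q n) \<longlonglongrightarrow> 0" by simp
  have "?J \<longlonglongrightarrow> ?c \<longleftrightarrow> ?q \<longlonglongrightarrow> 0"
  proof
    assume "?J \<longlonglongrightarrow> ?c"
    from tendsto_divide[OF tendsto_diff[OF tendsto_diff[OF this tendsto_const[of ?c]] lim] tendsto_const[of 2]]
    show "?q \<longlonglongrightarrow> 0" by simp
  next
    assume "?q \<longlonglongrightarrow> 0"
    from tendsto_add[OF tendsto_add[OF lim tendsto_mult[OF tendsto_const[of 2] this]] tendsto_const[of ?c]]
    show "?J \<longlonglongrightarrow> ?c" by simp
  qed
  also have "\<dots> \<longleftrightarrow> (\<lambda>n. ennreal (?q n)) \<longlonglongrightarrow> ennreal 0"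
    by (subst tendsto_ennreal_iff) (auto intro!: always_eventually Bochner_Integration.integral_nonneg)
  also have "(\<lambda>n. ennreal (?q n)) = cross"
    unfolding GF_integral[symmetric]
    by (intro ext nn_integral_eq_integral[symmetric] int) auto
  finally show ?thesis by simp
qed

end

theorem proposition4p3:
  fixes u :: "real ^ 'n \<Rightarrow> real"
    and U :: "nat \<Rightarrow> real ^ 'n \<Rightarrow> real"
    and \<alpha> p :: real
  assumes "0 < \<alpha>" and "\<alpha> < real CARD('n)" and "p \<ge> 1"
    and "\<And>n. U n \<in> borel_measurable lebesgue"
    and "AE x in lebesgue. (\<lambda>n. U n x) \<longlonglongrightarrow> u x"
    and "bounded_in_L2 (\<lambda>n. riesz_conv (\<alpha> / 2) (\<lambda>x. \<bar>U n x\<bar> powr p))"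
    and "\<not> (AE x in lebesgue. u x = 0)"
  shows "all_equivalent
    [ (\<lambda>n. \<integral>\<^sup>+x. ennreal \<bar>(riesz_potential (\<alpha> / 2) (\<lambda>y. \<bar>U n y\<bar> powr p) x)\<^sup>2
              - (riesz_potential (\<alpha> / 2) (\<lambda>y. \<bar>U n y - u y\<bar> powr p) x)\<^sup>2
              - (riesz_potential (\<alpha> / 2) (\<lambda>y. \<bar>u y\<bar> powr p) x)\<^sup>2\<bar> \<partial>lebesgue) \<longlonglongrightarrow> 0,
      (\<lambda>n. \<integral>x. (riesz_potential (\<alpha> / 2) (\<lambda>y. \<bar>U n y\<bar> powr p) x)\<^sup>2
              - (riesz_potential (\<alpha> / 2) (\<lambda>y. \<bar>U n y - u y\<bar> powr p) x)\<^sup>2 \<partial>lebesgue)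
        \<longlonglongrightarrow> (\<integral>x. (riesz_potential (\<alpha> / 2) (\<lambda>y. \<bar>u y\<bar> powr p) x)\<^sup>2 \<partial>lebesgue),
      converges_in_Lp_loc p U u,
      converges_in_measures (\<lambda>n x. \<bar>U n x\<bar> powr p) (\<lambda>x. \<bar>u x\<bar> powr p),
      converges_weakly_L2 (\<lambda>n. riesz_potential (\<alpha> / 2) (\<lambda>x. \<bar>U n x\<bar> powr p))
                          (riesz_potential (\<alpha> / 2) (\<lambda>x. \<bar>u x\<bar> powr p)) ]"
proof -
  have \<beta>: "0 < \<alpha> / 2" "\<alpha> / 2 < real DIM(real ^ 'n)"
    using assms(1,2) by auto
  obtain C where C: "\<And>n. (\<integral>\<^sup>+x. (riesz_conv (\<alpha> / 2) (\<lambda>x. \<bar>U n x\<bar> powr p) x)\<^sup>2 \<partial>lebesgue) \<le> ennreal C"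
    using assms(6) by (auto simp: bounded_in_L2_def)
  \<comment> \<open>The bound in the hypothesis may be negative, in which case it means \<open>0\<close>.\<close>
  interpret riesz_bounded_sequence U u "\<alpha> / 2" p "max 0 C"
  proof
    show "(\<integral>\<^sup>+x. (riesz_op (\<alpha> / 2) (\<lambda>y. ennreal (\<bar>U n y\<bar> powr p)) x)\<^sup>2 \<partial>lebesgue) \<le> ennreal (max 0 C)" for n
      using order.trans[OF C[of n] ennreal_leI[of C "max 0 C"]] unfolding riesz_conv_eq_riesz_op[OF \<beta>] by simp
  qed (use assms \<beta> in auto)
  note cross_iff = cross_null_iff[OF assms(7)]
  have weak: "converges_weakly_L2 F F\<^sub>0 \<longleftrightarrow> locally_null g"
    using converges_weakly_of_locally_null locally_null_of_converges_weakly locally_null_d_iff_g by blast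
  show ?thesis
    unfolding riesz_potential_eq all_equivalent_def
    by (simp add: strong_splitting_iff weak_splitting_iff cross_iff weak converges_in_Lp_loc_iff
        converges_in_measures_iff locally_null_d_iff_g)
qed

end
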